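(* Let $G\colon \mathcal{M}\to\mathcal{V}$ be as in the context. Then there is a left action of the monoidal category $\mathcal{Z}^{G}_{\mathcal{B}}(\mathcal{M})$ on the category $\mathcal{H}^{G}_{\mathcal{B}}(\mathcal{M})$, given on objects by $(V,c)\triangleright (W,d)=(V\otimes W, d^{V\triangleright W})$, where for every object $X$ of $\mathcal{M}$ $$d^{V\triangleright W}_X=\alpha_{G(X),V,W}\,(c_X\otimes \mathrm{id}_W)\,\alpha^{-1}_{V,G(X),W}\,(\mathrm{id}_V\otimes d_X)\,\alpha_{V,W,GPF(X)}\colon (V\otimes W)\otimes GPF(X)\to G(X)\otimes (V\otimes W),$$ for $(V,c)\in \mathcal{Z}^{G}_{\mathcal{B}}(\mathcal{M})$ and $(W,d)\in \mathcal{H}^{G}_{\mathcal{B}}(\mathcal{M})$.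
   Context: Conventions. Monoidal categories have associativity isomorphism $\alpha_{X,Y,Z}\colon (X\otimes Y)\otimes Z\to X\otimes(Y\otimes Z)$ and a strict unit $I$. Monoidal functors $G$ are strong, with coherence $\mu^G_{X,Y}\colon G(X\otimes Y)\to G(X)\otimes G(Y)$. Composition of maps and functors is written by juxtaposition. Setting. $(\mathcal{B},\Psi)$ is a strict braided monoidal category; $\mathcal{M}$ is a monoidal category with monoidal functors $F\colon\mathcal{M}\to\mathcal{B}$ and $P\colon\mathcal{B}\to\mathcal{M}$ and a monoidal natural isomorphism $\tau\colon FP\Rightarrow \mathrm{id}_{\mathcal{B}}$. $\mathcal{V}$ is a monoidal category with a monoidal functor $F'\colon\mathcal{V}\to\mathcal{B}$, and $G\colon\mathcal{M}\to\mathcal{V}$ is a monoidal functor with $F'G=F$. Mixed relative centers. Let $G_1,G_2\colon\mathcal{M}\to\mathcal{V}$ be monoidal functors with $F'G_i= F$ (for $G_2=GPF$ this is understood via the isomorphism $F'GPF=FPF\cong F$ induced by $\tau$). The category ${}^{G_1}\mathcal{Z}^{G_2}_{\mathcal{B}}(\mathcal{M})$ has as objects pairs $(V,c)$ with $V\in\mathcal{V}$ and $c_X\colon V\otimes G_2(X)\to G_1(X)\otimes V$ a natural isomorphism (in $X\in\mathcal{M}$) such that: (1) ($\otimes$-compatibility) $c_{X\otimes Y}$ equals the composite $V\otimes G_2(X\otimes Y)\cong V\otimes(G_2X\otimes G_2Y)\xrightarrow{\alpha^{-1}}(V\otimes G_2X)\otimes G_2Y\xrightarrow{c_X\otimes \mathrm{id}}(G_1X\otimes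 V)\otimes G_2Y\xrightarrow{\alpha}G_1X\otimes (V\otimes G_2Y)\xrightarrow{\mathrm{id}\otimes c_Y}G_1X\otimes (G_1Y\otimes V)\xrightarrow{\alpha^{-1}}(G_1X\otimes G_1Y)\otimes V\cong G_1(X\otimes Y)\otimes V$; (2) ($(F,P)$-admissibility) for each $X\in\mathcal{B}$ the composite $F'(V)\otimes X\cong F'(V)\otimes F'G_2P(X)\cong F'(V\otimes G_2P(X))\xrightarrow{F'(c_{P(X)})}F'(G_1P(X)\otimes V)\cong F'G_1P(X)\otimes F'(V)\cong X\otimes F'(V)$, using $\tau$ and $\mu^{F'}$, equals the braiding $\Psi_{F'(V),X}$. Morphisms $(V,c)\to(W,d)$ are morphisms $\vartheta\colon V\to W$ in $\mathcal{V}$ with $(\mathrm{id}\otimes\vartheta)c_X=d_X(\vartheta\otimes \mathrm{id})$ for all $X$. $\mathcal{Z}^G_{\mathcal{B}}(\mathcal{M}):={}^{G}\mathcal{Z}^{G}_{\mathcal{B}}(\mathcal{M})$ (relative Drinfeld center) is monoidal via $(V,c^V)\otimes(W,c^W)=(V\otimes W,c^{V\otimes W})$, $c^{V\otimes W}_X=\alpha_{G(X),V,W}(c^V_X\otimes \mathrm{id}_W)\alpha^{-1}_{V,G(X),W}(\mathrm{id}_V\otimes c^W_X)\alpha_{V,W,G(X)}$. $\mathcal{H}^G_{\mathcal{B}}(\mathcal{M}):={}^{G}\mathcal{Z}^{GPF}_{\mathcal{B}}(\mathcal{M})$ (relative Hopf center). A left action of a monoidal category on a category means a module category structure (action functor with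 coherent associativity isomorphism). *)

theory Defs
  imports Main "HOL-Library.FuncSet"
begin

record ('o, 'a) cat =
  Obj :: "'o set"
  Arr :: "'a set"
  Dom :: "'a \<Rightarrow> 'o"
  Cod :: "'a \<Rightarrow> 'o"
  Id :: "'o \<Rightarrow> 'a"
  Comp :: "'a \<Rightarrow> 'a \<Rightarrow> 'a"  (infixr "\<cdot>\<index>" 55)

definition hom :: "('o, 'a, 'z) cat_scheme \<Rightarrow> 'o \<Rightarrow> 'o \<Rightarrow> 'a set" where
  "hom C X Y = {f \<in> Arr C. Dom C f = X \<and> Cod C f = Y}"

definition inverse_arrows :: "('o, 'a, 'z) cat_scheme \<Rightarrow> 'a \<Rightarrow> 'a \<Rightarrow> bool" where
  "inverse_arrows C f g \<longleftrightarrow>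
     f \<in> Arr C \<and> g \<in> hom C (Cod C f) (Dom C f) \<and>
     g \<cdot>\<^bsub>C\<^esub> f = Id C (Dom C f) \<and> f \<cdot>\<^bsub>C\<^esub> g = Id C (Cod C f)"

definition iso :: "('o, 'a, 'z) cat_scheme \<Rightarrow> 'o \<Rightarrow> 'o \<Rightarrow> 'a set" where
  "iso C X Y = {f \<in> hom C X Y. \<exists>g. inverse_arrows C f g}"

text \<open>Meaningful for isomorphisms only, where the inverse is unique.\<close>

definition inv_arr :: "('o, 'a, 'z) cat_scheme \<Rightarrow> 'a \<Rightarrow> 'a" where
  "inv_arr C f = (THE g. inverse_arrows C f g)"

locale category =
  fixes C :: "('o, 'a, 'z) cat_scheme" (structure)
  assumes dom_obj: "f \<in> Arr C \<Longrightarrow> Dom C f \<in> Obj C"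
    and cod_obj: "f \<in> Arr C \<Longrightarrow> Cod C f \<in> Obj C"
    and id_hom: "X \<in> Obj C \<Longrightarrow> Id C X \<in> hom C X X"
    and comp_hom: "\<lbrakk>f \<in> hom C X Y; g \<in> hom C Y Z\<rbrakk> \<Longrightarrow> g \<cdot> f \<in> hom C X Z"
    and id_left: "f \<in> hom C X Y \<Longrightarrow> Id C Y \<cdot> f = f"
    and id_right: "f \<in> hom C X Y \<Longrightarrow> f \<cdot> Id C X = f"
    and comp_assoc: "\<lbrakk>f \<in> hom C W X; g \<in> hom C X Y; h \<in> hom C Y Z\<rbrakk> \<Longrightarrow>
      (h \<cdot> g) \<cdot> f = h \<cdot> (g \<cdot> f)"

definition prod_cat ::
  "('o, 'a, 'y) cat_scheme \<Rightarrow> ('p, 'b, 'z) cat_scheme \<Rightarrow> ('o \<times> 'p, 'a \<times> 'b) cat" where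
  "prod_cat C D =
    \<lparr>Obj = Obj C \<times> Obj D, Arr = Arr C \<times> Arr D,
     Dom = map_prod (Dom C) (Dom D), Cod = map_prod (Cod C) (Cod D),
     Id = map_prod (Id C) (Id D),
     Comp = (\<lambda>(g, g') (f, f'). (g \<cdot>\<^bsub>C\<^esub> f, g' \<cdot>\<^bsub>D\<^esub> f'))\<rparr>"

record ('o, 'a, 'p, 'b) func =
  ob :: "'o \<Rightarrow> 'p"
  ar :: "'a \<Rightarrow> 'b"

locale cat_functor = source: category C + target: category D
  for C :: "('o, 'a, 'y) cat_scheme" and D :: "('p, 'b, 'z) cat_scheme" +
  fixes F :: "('o, 'a, 'p, 'b, 'w) func_scheme"
  assumes ob_obj: "X \<in> Obj C \<Longrightarrow> ob F X \<in> Obj D"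
    and ar_hom: "f \<in> hom C X Y \<Longrightarrow> ar F f \<in> hom D (ob F X) (ob F Y)"
    and ar_id: "X \<in> Obj C \<Longrightarrow> ar F (Id C X) = Id D (ob F X)"
    and ar_comp: "\<lbrakk>f \<in> hom C X Y; g \<in> hom C Y Z\<rbrakk> \<Longrightarrow>
      ar F (g \<cdot>\<^bsub>C\<^esub> f) = ar F g \<cdot>\<^bsub>D\<^esub> ar F f"

text \<open>The tensor product is written \<open>\<otimes>\<close> on objects and \<open>\<boxtimes>\<close> on arrows.\<close>

record ('o, 'a) moncat = "('o, 'a) cat" +
  Tens_ob :: "'o \<Rightarrow> 'o \<Rightarrow> 'o"  (infixr "\<otimes>\<index>" 70)
  Tens_ar :: "'a \<Rightarrow> 'a \<Rightarrow> 'a"  (infixr "\<boxtimes>\<index>" 70)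
  Unit :: "'o"
  Assoc :: "'o \<Rightarrow> 'o \<Rightarrow> 'o \<Rightarrow> 'a"

text \<open>The unit is strict: the unit constraints are identities, so their naturality is
  \<open>unit_right_ar\<close> and \<open>unit_left_ar\<close>, and the triangle axiom reads \<open>\<alpha>\<^sub>X\<^sub>,\<^sub>I\<^sub>,\<^sub>Y = id\<close>.\<close>

locale monoidal_category = category C
  for C :: "('o, 'a) moncat" (structure) +
  assumes tensor_functor:
    "cat_functor (prod_cat C C) C \<lparr>ob = (\<lambda>(X, Y). X \<otimes> Y), ar = (\<lambda>(f, g). f \<boxtimes> g)\<rparr>"
    and unit_obj: "Unit C \<in> Obj C"
    and unit_right_ob: "X \<in> Obj C \<Longrightarrow> X \<otimes> Unit C = X"
    and unit_left_ob: "X \<in> Obj C \<Longrightarrow> Unit C \<otimes> X = X"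
    and unit_right_ar: "f \<in> Arr C \<Longrightarrow> f \<boxtimes> Id C (Unit C) = f"
    and unit_left_ar: "f \<in> Arr C \<Longrightarrow> Id C (Unit C) \<boxtimes> f = f"
    and assoc_iso: "\<lbrakk>X \<in> Obj C; Y \<in> Obj C; Z \<in> Obj C\<rbrakk> \<Longrightarrow>
      Assoc C X Y Z \<in> iso C ((X \<otimes> Y) \<otimes> Z) (X \<otimes> (Y \<otimes> Z))"
    and assoc_natural:
      "\<lbrakk>f \<in> hom C X X'; g \<in> hom C Y Y'; h \<in> hom C Z Z'\<rbrakk> \<Longrightarrow>
       (f \<boxtimes> (g \<boxtimes> h)) \<cdot> Assoc C X Y Z = Assoc C X' Y' Z' \<cdot> ((f \<boxtimes> g) \<boxtimes> h)"
    and pentagon: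
      "\<lbrakk>W \<in> Obj C; X \<in> Obj C; Y \<in> Obj C; Z \<in> Obj C\<rbrakk> \<Longrightarrow>
       (Id C W \<boxtimes> Assoc C X Y Z) \<cdot> Assoc C W (X \<otimes> Y) Z \<cdot> (Assoc C W X Y \<boxtimes> Id C Z) =
       Assoc C W X (Y \<otimes> Z) \<cdot> Assoc C (W \<otimes> X) Y Z"
    and triangle: "\<lbrakk>X \<in> Obj C; Y \<in> Obj C\<rbrakk> \<Longrightarrow> Assoc C X (Unit C) Y = Id C (X \<otimes> Y)"

locale strict_monoidal_category = monoidal_category C
  for C :: "('o, 'a) moncat" (structure) +
  assumes assoc_ob: "\<lbrakk>X \<in> Obj C; Y \<in> Obj C; Z \<in> Obj C\<rbrakk> \<Longrightarrow> (X \<otimes> Y) \<otimes> Z = X \<otimes> (Y \<otimes> Z)"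
    and assoc_id: "\<lbrakk>X \<in> Obj C; Y \<in> Obj C; Z \<in> Obj C\<rbrakk> \<Longrightarrow> Assoc C X Y Z = Id C (X \<otimes> (Y \<otimes> Z))"

locale braided_monoidal_category = monoidal_category C
  for C :: "('o, 'a) moncat" (structure) +
  fixes Psi :: "'o \<Rightarrow> 'o \<Rightarrow> 'a"
  assumes braiding_iso: "\<lbrakk>X \<in> Obj C; Y \<in> Obj C\<rbrakk> \<Longrightarrow> Psi X Y \<in> iso C (X \<otimes> Y) (Y \<otimes> X)"
    and braiding_natural: "\<lbrakk>f \<in> hom C X X'; g \<in> hom C Y Y'\<rbrakk> \<Longrightarrow>
      (g \<boxtimes> f) \<cdot> Psi X Y = Psi X' Y' \<cdot> (f \<boxtimes> g)"
    and hexagon1: "\<lbrakk>X \<in> Obj C; Y \<in> Obj C; Z \<in> Obj C\<rbrakk> \<Longrightarrow>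
      Assoc C Y Z X \<cdot> Psi X (Y \<otimes> Z) \<cdot> Assoc C X Y Z =
      (Id C Y \<boxtimes> Psi X Z) \<cdot> Assoc C Y X Z \<cdot> (Psi X Y \<boxtimes> Id C Z)"
    and hexagon2: "\<lbrakk>X \<in> Obj C; Y \<in> Obj C; Z \<in> Obj C\<rbrakk> \<Longrightarrow>
      inv_arr C (Assoc C Z X Y) \<cdot> Psi (X \<otimes> Y) Z \<cdot> inv_arr C (Assoc C X Y Z) =
      (Psi X Z \<boxtimes> Id C Y) \<cdot> inv_arr C (Assoc C X Z Y) \<cdot> (Id C X \<boxtimes> Psi Y Z)"

text \<open>Strong monoidal functors, with \<open>Mu G X Y : G(X \<otimes> Y) \<rightarrow> G(X) \<otimes> G(Y)\<close> and
  \<open>Eps G : G(I) \<rightarrow> I\<close>.\<close>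

record ('o, 'a, 'p, 'b) monfunc = "('o, 'a, 'p, 'b) func" +
  Mu :: "'o \<Rightarrow> 'o \<Rightarrow> 'b"
  Eps :: "'b"

locale monoidal_functor =
  source: monoidal_category C + target: monoidal_category D + cat_functor C D G
  for C :: "('o, 'a) moncat" and D :: "('p, 'b) moncat" and G :: "('o, 'a, 'p, 'b) monfunc" +
  assumes mu_iso: "\<lbrakk>X \<in> Obj C; Y \<in> Obj C\<rbrakk> \<Longrightarrow>
      Mu G X Y \<in> iso D (ob G (X \<otimes>\<^bsub>C\<^esub> Y)) (ob G X \<otimes>\<^bsub>D\<^esub> ob G Y)"
    and mu_natural: "\<lbrakk>f \<in> hom C X X'; g \<in> hom C Y Y'\<rbrakk> \<Longrightarrow>
      (ar G f \<boxtimes>\<^bsub>D\<^esub> ar G g) \<cdot>\<^bsub>D\<^esub> Mu G X Y = Mu G X' Y' \<cdot>\<^bsub>D\<^esub> ar G (f \<boxtimes>\<^bsub>C\<^esub> g)"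
    and eps_iso: "Eps G \<in> iso D (ob G (Unit C)) (Unit D)"
    and mu_assoc: "\<lbrakk>X \<in> Obj C; Y \<in> Obj C; Z \<in> Obj C\<rbrakk> \<Longrightarrow>
      (Id D (ob G X) \<boxtimes>\<^bsub>D\<^esub> Mu G Y Z) \<cdot>\<^bsub>D\<^esub> Mu G X (Y \<otimes>\<^bsub>C\<^esub> Z) \<cdot>\<^bsub>D\<^esub> ar G (Assoc C X Y Z) =
      Assoc D (ob G X) (ob G Y) (ob G Z) \<cdot>\<^bsub>D\<^esub>
        (Mu G X Y \<boxtimes>\<^bsub>D\<^esub> Id D (ob G Z)) \<cdot>\<^bsub>D\<^esub> Mu G (X \<otimes>\<^bsub>C\<^esub> Y) Z"
    and mu_unit_left: "X \<in> Obj C \<Longrightarrow>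
      (Eps G \<boxtimes>\<^bsub>D\<^esub> Id D (ob G X)) \<cdot>\<^bsub>D\<^esub> Mu G (Unit C) X = Id D (ob G X)"
    and mu_unit_right: "X \<in> Obj C \<Longrightarrow>
      (Id D (ob G X) \<boxtimes>\<^bsub>D\<^esub> Eps G) \<cdot>\<^bsub>D\<^esub> Mu G X (Unit C) = Id D (ob G X)"

definition id_monfunc :: "('o, 'a) moncat \<Rightarrow> ('o, 'a, 'o, 'a) monfunc" where
  "id_monfunc C =
    \<lparr>ob = (\<lambda>X. X), ar = (\<lambda>f. f), Mu = (\<lambda>X Y. Id C (X \<otimes>\<^bsub>C\<^esub> Y)), Eps = Id C (Unit C)\<rparr>"

text \<open>\<open>comp_monfunc E K G\<close> is the composite \<open>KG\<close> (first \<open>G\<close>, then \<open>K\<close>), where \<open>E\<close> is the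
  target of \<open>K\<close>.\<close>

definition comp_monfunc ::
  "('q, 'c) moncat \<Rightarrow> ('p, 'b, 'q, 'c) monfunc \<Rightarrow> ('o, 'a, 'p, 'b) monfunc
    \<Rightarrow> ('o, 'a, 'q, 'c) monfunc" where
  "comp_monfunc E K G =
    \<lparr>ob = (\<lambda>X. ob K (ob G X)), ar = (\<lambda>f. ar K (ar G f)),
     Mu = (\<lambda>X Y. Mu K (ob G X) (ob G Y) \<cdot>\<^bsub>E\<^esub> ar K (Mu G X Y)),
     Eps = Eps K \<cdot>\<^bsub>E\<^esub> ar K (Eps G)\<rparr>"

text \<open>Equality of monoidal functors with source \<open>C\<close>, disregarding the values of the
  underlying total functions outside \<open>C\<close>.\<close>

definition monfunc_eq ::
  "('o, 'a) moncat \<Rightarrow> ('o, 'a, 'p, 'b) monfunc \<Rightarrow> ('o, 'a, 'p, 'b) monfunc \<Rightarrow> bool" where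
  "monfunc_eq C F G \<longleftrightarrow>
     (\<forall>X\<in>Obj C. ob F X = ob G X) \<and> (\<forall>f\<in>Arr C. ar F f = ar G f) \<and>
     (\<forall>X\<in>Obj C. \<forall>Y\<in>Obj C. Mu F X Y = Mu G X Y) \<and> Eps F = Eps G"

locale monoidal_nat_iso =
  F: monoidal_functor C D F + G: monoidal_functor C D G
  for C :: "('o, 'a) moncat" and D :: "('p, 'b) moncat"
    and F G :: "('o, 'a, 'p, 'b) monfunc" +
  fixes t :: "'o \<Rightarrow> 'b"
  assumes component_iso: "X \<in> Obj C \<Longrightarrow> t X \<in> iso D (ob F X) (ob G X)"
    and natural: "f \<in> hom C X Y \<Longrightarrow> ar G f \<cdot>\<^bsub>D\<^esub> t X = t Y \<cdot>\<^bsub>D\<^esub> ar F f"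
    and monoidal: "\<lbrakk>X \<in> Obj C; Y \<in> Obj C\<rbrakk> \<Longrightarrow>
      (t X \<boxtimes>\<^bsub>D\<^esub> t Y) \<cdot>\<^bsub>D\<^esub> Mu F X Y = Mu G X Y \<cdot>\<^bsub>D\<^esub> t (X \<otimes>\<^bsub>C\<^esub> Y)"
    and monoidal_unit: "Eps G \<cdot>\<^bsub>D\<^esub> t (Unit C) = Eps F"

locale left_module_category = acting: monoidal_category Z + acted: category H
  for Z :: "('o, 'a) moncat" and H :: "('p, 'b, 'z) cat_scheme" +
  fixes act :: "('o \<times> 'p, 'a \<times> 'b, 'p, 'b) func"
    and massoc :: "'o \<Rightarrow> 'o \<Rightarrow> 'p \<Rightarrow> 'b"
    and munit :: "'p \<Rightarrow> 'b"
  assumes act_functor: "cat_functor (prod_cat Z H) H act"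
    and massoc_iso: "\<lbrakk>X \<in> Obj Z; Y \<in> Obj Z; N \<in> Obj H\<rbrakk> \<Longrightarrow>
      massoc X Y N \<in> iso H (ob act (X \<otimes>\<^bsub>Z\<^esub> Y, N)) (ob act (X, ob act (Y, N)))"
    and massoc_natural: "\<lbrakk>f \<in> hom Z X X'; g \<in> hom Z Y Y'; h \<in> hom H N N'\<rbrakk> \<Longrightarrow>
      ar act (f, ar act (g, h)) \<cdot>\<^bsub>H\<^esub> massoc X Y N =
      massoc X' Y' N' \<cdot>\<^bsub>H\<^esub> ar act (f \<boxtimes>\<^bsub>Z\<^esub> g, h)"
    and massoc_pentagon: "\<lbrakk>W \<in> Obj Z; X \<in> Obj Z; Y \<in> Obj Z; N \<in> Obj H\<rbrakk> \<Longrightarrow>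
      ar act (Id Z W, massoc X Y N) \<cdot>\<^bsub>H\<^esub> massoc W (X \<otimes>\<^bsub>Z\<^esub> Y) N \<cdot>\<^bsub>H\<^esub>
        ar act (Assoc Z W X Y, Id H N) =
      massoc W X (ob act (Y, N)) \<cdot>\<^bsub>H\<^esub> massoc (W \<otimes>\<^bsub>Z\<^esub> X) Y N"
    and munit_iso: "N \<in> Obj H \<Longrightarrow> munit N \<in> iso H (ob act (Unit Z, N)) N"
    and munit_natural: "h \<in> hom H N N' \<Longrightarrow>
      h \<cdot>\<^bsub>H\<^esub> munit N = munit N' \<cdot>\<^bsub>H\<^esub> ar act (Id Z (Unit Z), h)"
    and munit_triangle: "\<lbrakk>X \<in> Obj Z; N \<in> Obj H\<rbrakk> \<Longrightarrow>
      ar act (Id Z X, munit N) \<cdot>\<^bsub>H\<^esub> massoc X (Unit Z) N = Id H (ob act (X, N))"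

locale relative_setting =
  B: strict_monoidal_category B + B: braided_monoidal_category B Psi +
  F: monoidal_functor M B F + P: monoidal_functor B M P +
  tau: monoidal_nat_iso B B "comp_monfunc B F P" "id_monfunc B" tau +
  F': monoidal_functor V B F' + G: monoidal_functor M V G
  for B :: "('bo, 'ba) moncat" and Psi :: "'bo \<Rightarrow> 'bo \<Rightarrow> 'ba"
    and M :: "('mo, 'ma) moncat"
    and F :: "('mo, 'ma, 'bo, 'ba) monfunc" and P :: "('bo, 'ba, 'mo, 'ma) monfunc"
    and tau :: "'bo \<Rightarrow> 'ba"
    and V :: "('vo, 'va) moncat" and F' :: "('vo, 'va, 'bo, 'ba) monfunc"
    and G :: "('mo, 'ma, 'vo, 'va) monfunc" +
  assumes over_base: "monfunc_eq M (comp_monfunc B F' G) F"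

text \<open>The conditions on \<open>c\<^sub>X : A \<otimes> G\<^sub>2(X) \<rightarrow> G\<^sub>1(X) \<otimes> A\<close>, apart from admissibility.  Families indexed
  by the objects of \<open>M\<close> are extensional functions, so that two of them are equal if and only if
  their components are.\<close>

definition half_braiding ::
  "('mo, 'ma) moncat \<Rightarrow> ('vo, 'va) moncat
    \<Rightarrow> ('mo, 'ma, 'vo, 'va) monfunc \<Rightarrow> ('mo, 'ma, 'vo, 'va) monfunc
    \<Rightarrow> 'vo \<Rightarrow> ('mo \<Rightarrow> 'va) \<Rightarrow> bool" where
  "half_braiding M V G1 G2 A c \<longleftrightarrow>
     c \<in> extensional (Obj M) \<and>
     (\<forall>X\<in>Obj M. c X \<in> iso V (A \<otimes>\<^bsub>V\<^esub> ob G2 X) (ob G1 X \<otimes>\<^bsub>V\<^esub> A)) \<and>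
     (\<forall>X\<in>Obj M. \<forall>Y\<in>Obj M. \<forall>f\<in>hom M X Y.
        (ar G1 f \<boxtimes>\<^bsub>V\<^esub> Id V A) \<cdot>\<^bsub>V\<^esub> c X = c Y \<cdot>\<^bsub>V\<^esub> (Id V A \<boxtimes>\<^bsub>V\<^esub> ar G2 f)) \<and>
     (\<forall>X\<in>Obj M. \<forall>Y\<in>Obj M.
        c (X \<otimes>\<^bsub>M\<^esub> Y) =
        (inv_arr V (Mu G1 X Y) \<boxtimes>\<^bsub>V\<^esub> Id V A) \<cdot>\<^bsub>V\<^esub>
        inv_arr V (Assoc V (ob G1 X) (ob G1 Y) A) \<cdot>\<^bsub>V\<^esub>
        (Id V (ob G1 X) \<boxtimes>\<^bsub>V\<^esub> c Y) \<cdot>\<^bsub>V\<^esub>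
        Assoc V (ob G1 X) A (ob G2 Y) \<cdot>\<^bsub>V\<^esub>
        (c X \<boxtimes>\<^bsub>V\<^esub> Id V (ob G2 Y)) \<cdot>\<^bsub>V\<^esub>
        inv_arr V (Assoc V A (ob G2 X) (ob G2 Y)) \<cdot>\<^bsub>V\<^esub>
        (Id V A \<boxtimes>\<^bsub>V\<^esub> Mu G2 X Y))"

text \<open>Here \<open>s1 X : F'G\<^sub>1P(X) \<rightarrow> X\<close> and \<open>s2 X : F'G\<^sub>2P(X) \<rightarrow> X\<close> are the isomorphisms that are used
  to identify the two ends of \<open>F'(c\<^sub>P\<^sub>(\<^sub>X\<^sub>))\<close> with those of the braiding of \<open>F'(A)\<close> and \<open>X\<close>.\<close>

definition admissible ::
  "('bo, 'ba) moncat \<Rightarrow> ('bo \<Rightarrow> 'bo \<Rightarrow> 'ba) \<Rightarrow> ('bo, 'ba, 'mo, 'ma) monfunc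
    \<Rightarrow> ('vo, 'va, 'bo, 'ba) monfunc
    \<Rightarrow> ('mo, 'ma, 'vo, 'va) monfunc \<Rightarrow> ('bo \<Rightarrow> 'ba)
    \<Rightarrow> ('mo, 'ma, 'vo, 'va) monfunc \<Rightarrow> ('bo \<Rightarrow> 'ba)
    \<Rightarrow> 'vo \<Rightarrow> ('mo \<Rightarrow> 'va) \<Rightarrow> bool" where
  "admissible B Psi P F' G1 s1 G2 s2 A c \<longleftrightarrow>
     (\<forall>X\<in>Obj B.
        (s1 X \<boxtimes>\<^bsub>B\<^esub> Id B (ob F' A)) \<cdot>\<^bsub>B\<^esub>
        Mu F' (ob G1 (ob P X)) A \<cdot>\<^bsub>B\<^esub>
        ar F' (c (ob P X)) \<cdot>\<^bsub>B\<^esub>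
        inv_arr B (Mu F' A (ob G2 (ob P X))) \<cdot>\<^bsub>B\<^esub>
        (Id B (ob F' A) \<boxtimes>\<^bsub>B\<^esub> inv_arr B (s2 X))
        = Psi (ob F' A) X)"

text \<open>In the mixed center, \<open>th1\<close> and \<open>th2\<close> are the natural isomorphisms \<open>F'G\<^sub>1 \<rightarrow> F\<close> and
  \<open>F'G\<^sub>2 \<rightarrow> F\<close>; whiskering with \<open>P\<close> and composing with \<open>\<tau>\<close> identifies \<open>F'G\<^sub>iP(X)\<close> with \<open>X\<close>.
  An arrow carries its domain and codomain along with the underlying arrow of \<open>V\<close>.\<close>

definition mixed_center ::
  "('bo, 'ba) moncat \<Rightarrow> ('bo \<Rightarrow> 'bo \<Rightarrow> 'ba) \<Rightarrow> ('mo, 'ma) moncat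
    \<Rightarrow> ('bo, 'ba, 'mo, 'ma) monfunc \<Rightarrow> ('bo \<Rightarrow> 'ba)
    \<Rightarrow> ('vo, 'va) moncat \<Rightarrow> ('vo, 'va, 'bo, 'ba) monfunc
    \<Rightarrow> ('mo, 'ma, 'vo, 'va) monfunc \<Rightarrow> ('mo \<Rightarrow> 'ba)
    \<Rightarrow> ('mo, 'ma, 'vo, 'va) monfunc \<Rightarrow> ('mo \<Rightarrow> 'ba)
    \<Rightarrow> ('vo \<times> ('mo \<Rightarrow> 'va), ('vo \<times> ('mo \<Rightarrow> 'va)) \<times> 'va \<times> ('vo \<times> ('mo \<Rightarrow> 'va))) cat" where
  "mixed_center B Psi M P tau V F' G1 th1 G2 th2 =
    (let Ob = {(A, c). A \<in> Obj V \<and> half_braiding M V G1 G2 A c \<and>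
                admissible B Psi P F' G1 (\<lambda>X. tau X \<cdot>\<^bsub>B\<^esub> th1 (ob P X))
                                     G2 (\<lambda>X. tau X \<cdot>\<^bsub>B\<^esub> th2 (ob P X)) A c}
     in \<lparr>Obj = Ob,
         Arr = {((A, c), t, (A', c')). (A, c) \<in> Ob \<and> (A', c') \<in> Ob \<and> t \<in> hom V A A' \<and>
                (\<forall>X\<in>Obj M. (Id V (ob G1 X) \<boxtimes>\<^bsub>V\<^esub> t) \<cdot>\<^bsub>V\<^esub> c X =
                           c' X \<cdot>\<^bsub>V\<^esub> (t \<boxtimes>\<^bsub>V\<^esub> Id V (ob G2 X)))},
         Dom = (\<lambda>(x, t, y). x),
         Cod = (\<lambda>(x, t, y). y),
         Id = (\<lambda>x. (x, Id V (fst x), x)),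
         Comp = (\<lambda>(y', u, z) (x, t, y). (x, u \<cdot>\<^bsub>V\<^esub> t, z))\<rparr>)"

definition tensor_half_braiding ::
  "('mo, 'ma) moncat \<Rightarrow> ('vo, 'va) moncat
    \<Rightarrow> ('mo, 'ma, 'vo, 'va) monfunc
    \<Rightarrow> 'vo \<times> ('mo \<Rightarrow> 'va) \<Rightarrow> 'vo \<times> ('mo \<Rightarrow> 'va) \<Rightarrow> 'vo \<times> ('mo \<Rightarrow> 'va)" where
  "tensor_half_braiding M V G =
    (\<lambda>(A, c) (A', c').
      (A \<otimes>\<^bsub>V\<^esub> A',
       \<lambda>X\<in>Obj M.
         Assoc V (ob G X) A A' \<cdot>\<^bsub>V\<^esub>
         (c X \<boxtimes>\<^bsub>V\<^esub> Id V A') \<cdot>\<^bsub>V\<^esub>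
         inv_arr V (Assoc V A (ob G X) A') \<cdot>\<^bsub>V\<^esub>
         (Id V A \<boxtimes>\<^bsub>V\<^esub> c' X) \<cdot>\<^bsub>V\<^esub>
         Assoc V A A' (ob G X)))"

definition relative_drinfeld_center ::
  "('bo, 'ba) moncat \<Rightarrow> ('bo \<Rightarrow> 'bo \<Rightarrow> 'ba) \<Rightarrow> ('mo, 'ma) moncat
    \<Rightarrow> ('mo, 'ma, 'bo, 'ba) monfunc \<Rightarrow> ('bo, 'ba, 'mo, 'ma) monfunc \<Rightarrow> ('bo \<Rightarrow> 'ba)
    \<Rightarrow> ('vo, 'va) moncat \<Rightarrow> ('vo, 'va, 'bo, 'ba) monfunc
    \<Rightarrow> ('mo, 'ma, 'vo, 'va) monfunc
    \<Rightarrow> ('vo \<times> ('mo \<Rightarrow> 'va), ('vo \<times> ('mo \<Rightarrow> 'va)) \<times> 'va \<times> ('vo \<times> ('mo \<Rightarrow> 'va))) moncat" where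
  "relative_drinfeld_center B Psi M F P tau V F' G =
    (let th = (\<lambda>X. Id B (ob F X));
         Z = mixed_center B Psi M P tau V F' G th G th;
         T = tensor_half_braiding M V G
     in \<lparr>Obj = Obj Z, Arr = Arr Z, Dom = Dom Z, Cod = Cod Z, Id = Id Z, Comp = Comp Z,
         Tens_ob = T,
         Tens_ar = (\<lambda>(x, t, y) (x', t', y'). (T x x', t \<boxtimes>\<^bsub>V\<^esub> t', T y y')),
         Unit = (Unit V, \<lambda>X\<in>Obj M. Id V (ob G X)),
         Assoc = (\<lambda>x y z. (T (T x y) z, Assoc V (fst x) (fst y) (fst z), T x (T y z)))\<rparr>)"

text \<open>For \<open>G\<^sub>2 = GPF\<close> the isomorphism \<open>F'G\<^sub>2 = FPF \<rightarrow> F\<close> has the components \<open>\<tau>\<^sub>F\<^sub>(\<^sub>X\<^sub>)\<close>.\<close>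

definition relative_hopf_center ::
  "('bo, 'ba) moncat \<Rightarrow> ('bo \<Rightarrow> 'bo \<Rightarrow> 'ba) \<Rightarrow> ('mo, 'ma) moncat
    \<Rightarrow> ('mo, 'ma, 'bo, 'ba) monfunc \<Rightarrow> ('bo, 'ba, 'mo, 'ma) monfunc \<Rightarrow> ('bo \<Rightarrow> 'ba)
    \<Rightarrow> ('vo, 'va) moncat \<Rightarrow> ('vo, 'va, 'bo, 'ba) monfunc
    \<Rightarrow> ('mo, 'ma, 'vo, 'va) monfunc
    \<Rightarrow> ('vo \<times> ('mo \<Rightarrow> 'va), ('vo \<times> ('mo \<Rightarrow> 'va)) \<times> 'va \<times> ('vo \<times> ('mo \<Rightarrow> 'va))) cat" where
  "relative_hopf_center B Psi M F P tau V F' G =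
    mixed_center B Psi M P tau V F'
      G (\<lambda>X. Id B (ob F X))
      (comp_monfunc V G (comp_monfunc M P F)) (\<lambda>X. tau (ob F X))"

end

theory Submission
  imports Defs
begin

text \<open>The idea is to look at a single component of a half-braiding.  Call an arrow \<open>A \<otimes> x \<rightarrow> y \<otimes> A\<close> a
  crossing: it carries \<open>A\<close> past \<open>x\<close>, and \<open>x\<close> comes out as \<open>y\<close>.  Crossings can be pasted in two
  directions.  A crossing of \<open>B\<close> from \<open>w\<close> to \<open>x\<close> followed by one of \<open>A\<close> from \<open>x\<close> to \<open>y\<close> gives a
  crossing of \<open>A \<otimes> B\<close> from \<open>w\<close> to \<open>y\<close> (\<open>cross_pair\<close>); this is the formula for the tensor product
  of the center and for the action.  Two crossings of the same \<open>A\<close>, from \<open>x\<close> to \<open>y\<close> and from \<open>x'\<close>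
  to \<open>y'\<close>, give a crossing of \<open>A\<close> from \<open>x \<otimes> x'\<close> to \<open>y \<otimes> y'\<close> (\<open>cross_past_pair\<close>); this is what
  tensor-compatibility of a half-braiding is about.

  Everything follows from a few properties of these pastings.  The two directions satisfy an
  interchange law (\<open>interchange\<close>), so a pasting of tensor-compatible families is again
  tensor-compatible.  The first pasting is associative up to the associator (\<open>cross_pair_assoc\<close>),
  so the associators of \<open>V\<close> are morphisms between centers.  It is natural in all objects involved
  (\<open>cross_pair_natural\<close>), which gives the naturality of the pasted half-braiding and the action on
  morphisms, and it is unital (\<open>cross_pair_unit_left\<close>, \<open>cross_pair_unit_right\<close>).  Finally, a
  monoidal functor preserves it (\<open>transport_cross_pair\<close>), and the second hexagon axiom says
  precisely that the braiding of \<open>X \<otimes> Y\<close> is the pasting of the braidings of \<open>X\<close> and \<open>Y\<close>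
  (\<open>psi_cross_pair\<close>); together these show that a pasting of admissible half-braidings is
  admissible.

  The middle functor is free in all of this: pasting is a functor
  \<open>\<^bold>Z(G\<^sub>1, G\<^sub>2) \<times> \<^bold>Z(G\<^sub>2, G\<^sub>3) \<rightarrow> \<^bold>Z(G\<^sub>1, G\<^sub>3)\<close> of mixed centers, with associativity and unit
  isomorphisms taken from \<open>V\<close> (\<open>hb_tensor_functor\<close>, \<open>hb_assoc_iso\<close>, \<open>hb_tensor_unit\<close>).  With all
  functors equal to \<open>G\<close> this is the monoidal structure of the relative Drinfeld center
  (\<open>monoidal_category_center\<close>), and with \<open>G\<^sub>1 = G\<^sub>2 = G\<close> and \<open>G\<^sub>3 = GPF\<close> it is the action on the
  relative Hopf center (\<open>center_acts\<close>).\<close>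

section \<open>Arrows, composites and inverses\<close>

context category
begin

lemma homI: "f \<in> Arr C \<Longrightarrow> Dom C f = X \<Longrightarrow> Cod C f = Y \<Longrightarrow> f \<in> hom C X Y"
  by (simp add: hom_def)

lemma homD: "f \<in> hom C X Y \<Longrightarrow> f \<in> Arr C \<and> Dom C f = X \<and> Cod C f = Y"
  by (simp add: hom_def)

lemma hom_obD: "f \<in> hom C X Y \<Longrightarrow> X \<in> Obj C \<and> Y \<in> Obj C"
  using dom_obj cod_obj by (auto simp: hom_def)

declare dom_obj [simp] cod_obj [simp]

lemma arr_id [simp]:
  assumes "X \<in> Obj C"
  shows "Id C X \<in> Arr C" "Dom C (Id C X) = X" "Cod C (Id C X) = X"
  using id_hom [OF assms] by (auto simp: hom_def)

lemma arr_comp [simp]: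
  assumes "f \<in> Arr C" "g \<in> Arr C" "Dom C g = Cod C f"
  shows "g \<cdot> f \<in> Arr C" "Dom C (g \<cdot> f) = Dom C f" "Cod C (g \<cdot> f) = Cod C g"
  using comp_hom [of f "Dom C f" "Cod C f" g "Cod C g"] assms by (auto simp: hom_def)

lemma comp_id_left [simp]: "f \<in> Arr C \<Longrightarrow> Cod C f = Y \<Longrightarrow> Id C Y \<cdot> f = f"
  using id_left by (auto simp: hom_def)

lemma comp_id_right [simp]: "f \<in> Arr C \<Longrightarrow> Dom C f = X \<Longrightarrow> f \<cdot> Id C X = f"
  using id_right by (auto simp: hom_def)

lemma comp_assoc_arr [simp]:
  assumes "f \<in> Arr C" "g \<in> Arr C" "h \<in> Arr C" "Dom C g = Cod C f" "Dom C h = Cod C g"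
  shows "(h \<cdot> g) \<cdot> f = h \<cdot> g \<cdot> f"
  using comp_assoc [of f "Dom C f" "Cod C f" g "Cod C g" h "Cod C h"] assms by (auto simp: hom_def)

text \<open>The simplifier brackets composites to the right, where the left side of an equation \<open>h \<cdot> g = k\<close>
  is no longer a subterm of \<open>h \<cdot> g \<cdot> f\<close>; this form makes such an equation applicable there.\<close>

lemma reassoc:
  assumes "h \<cdot> g = k" "f \<in> Arr C" "g \<in> Arr C" "h \<in> Arr C" "Dom C g = Cod C f" "Dom C h = Cod C g"
  shows "h \<cdot> g \<cdot> f = k \<cdot> f"
  using assms comp_assoc_arr by metis

lemma inverse_arrows_unique:
  assumes "inverse_arrows C f g" "inverse_arrows C f g'"
  shows "g = g'"
proof -
  have "g = g \<cdot> (f \<cdot> g')" using assms by (simp add: inverse_arrows_def hom_def)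
  also have "\<dots> = (g \<cdot> f) \<cdot> g'" using assms by (subst comp_assoc_arr) (auto simp: inverse_arrows_def
    hom_def)
  also have "\<dots> = g'" using assms by (simp add: inverse_arrows_def hom_def)
  finally show ?thesis .
qed

lemma inv_arr_eqI: "inverse_arrows C f g \<Longrightarrow> inv_arr C f = g"
  unfolding inv_arr_def using inverse_arrows_unique by blast

text \<open>A property of the arrow alone, so that the simplifier can propagate invertibility through
  composites and tensor products before their domains and codomains have been computed.\<close>

definition invertible where "invertible f \<longleftrightarrow> (\<exists>g. inverse_arrows C f g)"

lemma isoD: "f \<in> iso C X Y \<Longrightarrow> invertible f \<and> f \<in> Arr C \<and> Dom C f = X \<and> Cod C f = Y"
  by (auto simp: iso_def hom_def invertible_def)

lemma isoI: "invertible f \<Longrightarrow> Dom C f = X \<Longrightarrow> Cod C f = Y \<Longrightarrow> f \<in> iso C X Y"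
  by (auto simp: iso_def hom_def invertible_def inverse_arrows_def)

lemma invertibleI:
  assumes "f \<in> Arr C" "g \<in> Arr C" "Dom C g = Cod C f" "Cod C g = Dom C f"
    "g \<cdot> f = Id C (Dom C f)" "f \<cdot> g = Id C (Cod C f)"
  shows "invertible f" "inv_arr C f = g"
proof -
  have *: "inverse_arrows C f g" using assms by (auto simp: inverse_arrows_def hom_def)
  show "invertible f" "inv_arr C f = g" using * inv_arr_eqI by (auto simp: invertible_def)
qed

lemma invertible_arr: "invertible f \<Longrightarrow> f \<in> Arr C"
  by (auto simp: invertible_def inverse_arrows_def)

lemma inv_arr_simps [simp]:
  assumes "invertible f"
  shows "inv_arr C f \<in> Arr C" "Dom C (inv_arr C f) = Cod C f" "Cod C (inv_arr C f) = Dom C f"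
    "inv_arr C f \<cdot> f = Id C (Dom C f)" "f \<cdot> inv_arr C f = Id C (Cod C f)"
proof -
  obtain g where g: "inverse_arrows C f g" using assms by (auto simp: invertible_def)
  then have "inv_arr C f = g" by (rule inv_arr_eqI)
  with g show "inv_arr C f \<in> Arr C" "Dom C (inv_arr C f) = Cod C f" "Cod C (inv_arr C f) = Dom C f"
    "inv_arr C f \<cdot> f = Id C (Dom C f)" "f \<cdot> inv_arr C f = Id C (Cod C f)"
    by (auto simp: inverse_arrows_def hom_def)
qed

lemma inv_arr_cancel [simp]:
  assumes "invertible f" "h \<in> Arr C"
  shows "Cod C h = Dom C f \<Longrightarrow> inv_arr C f \<cdot> f \<cdot> h = h"
    "Cod C h = Cod C f \<Longrightarrow> f \<cdot> inv_arr C f \<cdot> h = h"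
  using assms invertible_arr [OF assms(1)]
  by (subst comp_assoc_arr [symmetric]; simp)+

lemma invertible_comp [simp]:
  assumes "invertible f" "invertible g" "Dom C g = Cod C f"
  shows "invertible (g \<cdot> f)"
  using assms invertible_arr [OF assms(1)] invertible_arr [OF assms(2)]
  by (intro invertibleI(1) [where g = "inv_arr C f \<cdot> inv_arr C g"]) auto

lemma invertible_inv [simp]: "invertible f \<Longrightarrow> invertible (inv_arr C f)"
  using invertible_arr by (intro invertibleI(1) [where g = f]) auto

lemma invertible_id [simp]: "X \<in> Obj C \<Longrightarrow> invertible (Id C X)"
  by (intro invertibleI(1) [where g = "Id C X"]) auto

lemma inv_id [simp]: "X \<in> Obj C \<Longrightarrow> inv_arr C (Id C X) = Id C X"
  by (intro invertibleI(2)) auto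

lemma cancel_left:
  assumes "invertible f" "f \<cdot> g = f \<cdot> h" "g \<in> Arr C" "h \<in> Arr C" "Cod C g = Dom C f" "Cod C h = Dom C f"
  shows "g = h"
  using inv_arr_cancel(1) [OF assms(1)] assms by metis

lemma cancel_right:
  assumes "invertible f" "g \<cdot> f = h \<cdot> f" "g \<in> Arr C" "h \<in> Arr C" "Dom C g = Cod C f" "Dom C h = Cod C f"
  shows "g = h"
proof -
  have "g = (g \<cdot> f) \<cdot> inv_arr C f" using assms(1,3-) invertible_arr [OF assms(1)] by simp
  also have "\<dots> = (h \<cdot> f) \<cdot> inv_arr C f" by (simp only: assms(2))
  also have "\<dots> = h" using assms(1,3-) invertible_arr [OF assms(1)] by simp
  finally show ?thesis .
qed

end

section \<open>Coherence for a strict unit\<close>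

context monoidal_category
begin

abbreviation al where "al X Y Z \<equiv> Assoc C X Y Z"
abbreviation ai where "ai X Y Z \<equiv> inv_arr C (Assoc C X Y Z)"

lemma tens_ob [simp]: "X \<in> Obj C \<Longrightarrow> Y \<in> Obj C \<Longrightarrow> X \<otimes> Y \<in> Obj C"
  using cat_functor.ob_obj [OF tensor_functor, of "(X, Y)"] by (simp add: prod_cat_def)

lemma tens_ar [simp]:
  assumes "f \<in> Arr C" "g \<in> Arr C"
  shows "f \<boxtimes> g \<in> Arr C" "Dom C (f \<boxtimes> g) = Dom C f \<otimes> Dom C g"
    "Cod C (f \<boxtimes> g) = Cod C f \<otimes> Cod C g"
  using cat_functor.ar_hom [OF tensor_functor, of "(f, g)" "(Dom C f, Dom C g)"
    "(Cod C f, Cod C g)"] assms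
  by (auto simp: prod_cat_def hom_def)

lemma tens_id [simp]: "X \<in> Obj C \<Longrightarrow> Y \<in> Obj C \<Longrightarrow> Id C X \<boxtimes> Id C Y = Id C (X \<otimes> Y)"
  using cat_functor.ar_id [OF tensor_functor, of "(X, Y)"] by (simp add: prod_cat_def)

lemma tens_comp:
  assumes "f \<in> Arr C" "g \<in> Arr C" "f' \<in> Arr C" "g' \<in> Arr C" "Dom C g = Cod C f" "Dom C g' = Cod C f'"
  shows "(g \<boxtimes> g') \<cdot> (f \<boxtimes> f') = (g \<cdot> f) \<boxtimes> (g' \<cdot> f')"
  using cat_functor.ar_comp [OF tensor_functor, of "(f, f')" "(Dom C f, Dom C f')" "(Cod C f, Cod C f')"
     "(g, g')" "(Cod C g, Cod C g')"] assms
  by (auto simp: prod_cat_def hom_def)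

lemma tens_comp_rest:
  assumes "f \<in> Arr C" "g \<in> Arr C" "f' \<in> Arr C" "g' \<in> Arr C" "Dom C g = Cod C f" "Dom C g' = Cod C f'"
    "h \<in> Arr C" "Cod C h = Dom C f \<otimes> Dom C f'"
  shows "(g \<boxtimes> g') \<cdot> (f \<boxtimes> f') \<cdot> h = ((g \<cdot> f) \<boxtimes> (g' \<cdot> f')) \<cdot> h"
  using assms by (intro reassoc tens_comp) auto

lemma invertible_tens [simp]:
  assumes "invertible f" "invertible g"
  shows "invertible (f \<boxtimes> g)"
  using assms invertible_arr [OF assms(1)] invertible_arr [OF assms(2)]
  by (intro invertibleI(1) [where g = "inv_arr C f \<boxtimes> inv_arr C g"]) (auto simp: tens_comp)

lemma inv_tens:
  assumes "invertible f" "invertible g"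
  shows "inv_arr C (f \<boxtimes> g) = inv_arr C f \<boxtimes> inv_arr C g"
  using assms invertible_arr [OF assms(1)] invertible_arr [OF assms(2)]
  by (intro invertibleI(2)) (auto simp: tens_comp)

lemma tens_inv_cancel [simp]:
  assumes "invertible f" "X \<in> Obj C" "h \<in> Arr C"
  shows "Cod C h = X \<otimes> Cod C f \<Longrightarrow> (Id C X \<boxtimes> f) \<cdot> (Id C X \<boxtimes> inv_arr C f) \<cdot> h = h"
    "Cod C h = X \<otimes> Dom C f \<Longrightarrow> (Id C X \<boxtimes> inv_arr C f) \<cdot> (Id C X \<boxtimes> f) \<cdot> h = h"
    "Cod C h = Cod C f \<otimes> X \<Longrightarrow> (f \<boxtimes> Id C X) \<cdot> (inv_arr C f \<boxtimes> Id C X) \<cdot> h = h"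
    "Cod C h = Dom C f \<otimes> X \<Longrightarrow> (inv_arr C f \<boxtimes> Id C X) \<cdot> (f \<boxtimes> Id C X) \<cdot> h = h"
  using assms invertible_arr [OF assms(1)] by (simp_all add: tens_comp_rest)

lemma al_simps [simp]:
  assumes "X \<in> Obj C" "Y \<in> Obj C" "Z \<in> Obj C"
  shows "invertible (al X Y Z)" "al X Y Z \<in> Arr C" "Dom C (al X Y Z) = (X \<otimes> Y) \<otimes> Z"
    "Cod C (al X Y Z) = X \<otimes> Y \<otimes> Z"
  using isoD [OF assoc_iso [OF assms]] by auto

lemma al_nat:
  assumes "f \<in> Arr C" "g \<in> Arr C" "h \<in> Arr C"
  shows "al (Cod C f) (Cod C g) (Cod C h) \<cdot> ((f \<boxtimes> g) \<boxtimes> h) = (f \<boxtimes> g \<boxtimes> h) \<cdot> al (Dom C f) (Dom C g)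
    (Dom C h)"
  using assoc_natural [of f "Dom C f" "Cod C f" g "Dom C g" "Cod C g" h "Dom C h" "Cod C h"] assms
    by (auto simp: hom_def)

lemma ai_nat:
  assumes "f \<in> Arr C" "g \<in> Arr C" "h \<in> Arr C"
  shows "ai (Cod C f) (Cod C g) (Cod C h) \<cdot> (f \<boxtimes> g \<boxtimes> h) = ((f \<boxtimes> g) \<boxtimes> h) \<cdot> ai (Dom C f) (Dom C g)
    (Dom C h)"
proof (rule cancel_left)
  show "al (Cod C f) (Cod C g) (Cod C h) \<cdot> ai (Cod C f) (Cod C g) (Cod C h) \<cdot> (f \<boxtimes> g \<boxtimes> h)
    = al (Cod C f) (Cod C g) (Cod C h) \<cdot> ((f \<boxtimes> g) \<boxtimes> h) \<cdot> ai (Dom C f) (Dom C g) (Dom C h)"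
    using assms by (subst reassoc [OF al_nat [OF assms]]) auto
qed (use assms in auto)

text \<open>With units in the first two places, the pentagon and the triangle axiom make the associator
  idempotent, and an invertible idempotent is an identity.  The same argument with units in the
  last two places gives \<open>al_unit_right\<close>.\<close>

lemma al_unit_left [simp]:
  assumes [simp]: "X \<in> Obj C" "Y \<in> Obj C"
  shows "al (Unit C) X Y = Id C (X \<otimes> Y)"
proof -
  note [simp] = unit_obj unit_left_ob triangle unit_left_ar
  have "al (Unit C) X Y \<cdot> al (Unit C) X Y = al (Unit C) X Y"
    using pentagon [of "Unit C" "Unit C" X Y] by simp
  then have "al (Unit C) X Y \<cdot> al (Unit C) X Y = al (Unit C) X Y \<cdot> Id C (X \<otimes> Y)"
    by simp
  then show ?thesis by (rule cancel_left [rotated]) auto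
qed

lemma al_unit_right [simp]:
  assumes [simp]: "X \<in> Obj C" "Y \<in> Obj C"
  shows "al X Y (Unit C) = Id C (X \<otimes> Y)"
proof -
  note [simp] = unit_obj unit_left_ob unit_right_ob triangle unit_right_ar
  have t: "al Z (Unit C) (Unit C) = Id C Z" if "Z \<in> Obj C" for Z
    using triangle [of Z "Unit C"] that by simp
  have "al X Y (Unit C) \<cdot> al X Y (Unit C) = al X Y (Unit C)"
    using pentagon [of X Y "Unit C" "Unit C"] by (simp add: t)
  then have "al X Y (Unit C) \<cdot> al X Y (Unit C) = al X Y (Unit C) \<cdot> Id C (X \<otimes> Y)"
    by simp
  then show ?thesis by (rule cancel_left [rotated]) auto
qed

section \<open>Crossings\<close>

text \<open>The components of a half-braiding and the braiding itself have this shape: \<open>A\<close> is carried past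
  \<open>x\<close>, which turns into \<open>y\<close>.\<close>

abbreviation crossing where "crossing A y x f \<equiv> f \<in> Arr C \<and> Dom C f = A \<otimes> x \<and> Cod C f = y \<otimes> A"

text \<open>The action of a crossing on the first two factors of \<open>A \<otimes> (x \<otimes> Z)\<close>.  In terms of these arrows
  both ways of pasting crossings are composites of whiskered crossings, without associators
  between them (\<open>whisker_cross_pair\<close>, \<open>whisker_cross_past_pair\<close>), so that the diagram chases below
  hardly see the associator.\<close>

definition whisker where
  "whisker A y x f Z = al y A Z \<cdot> (f \<boxtimes> Id C Z) \<cdot> ai A x Z"

text \<open>First \<open>B\<close> is carried past \<open>w\<close>, which turns into \<open>x\<close>; then \<open>A\<close> is carried past \<open>x\<close>, which turns
  into \<open>y\<close>.\<close>

definition cross_pair where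
  "cross_pair A B y x w f g =
     al y A B \<cdot> (f \<boxtimes> Id C B) \<cdot> ai A x B \<cdot> (Id C A \<boxtimes> g) \<cdot> al A B w"

text \<open>Tensor-compatibility of a half-braiding compares its component at a tensor product with this
  pasting of its components at the factors (\<open>half_braiding_iff\<close>).\<close>

definition cross_past_pair where
  "cross_past_pair A y y' x x' f h =
     ai y y' A \<cdot> (Id C y \<boxtimes> h) \<cdot> al y A x' \<cdot> (f \<boxtimes> Id C x') \<cdot> ai A x x'"

lemma whisker_arr [simp]:
  assumes "crossing A y x f" "A \<in> Obj C" "x \<in> Obj C" "y \<in> Obj C" "Z \<in> Obj C"
  shows "whisker A y x f Z \<in> Arr C" "Dom C (whisker A y x f Z) = A \<otimes> x \<otimes> Z"
    "Cod C (whisker A y x f Z) = y \<otimes> A \<otimes> Z"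
  using assms by (simp_all add: whisker_def)

lemma cross_pair_whisker:
  assumes "crossing A y x f" "crossing B x w g"
    "A \<in> Obj C" "B \<in> Obj C" "x \<in> Obj C" "y \<in> Obj C" "w \<in> Obj C"
  shows "cross_pair A B y x w f g = whisker A y x f B \<cdot> (Id C A \<boxtimes> g) \<cdot> al A B w"
  using assms by (simp add: whisker_def cross_pair_def)

lemma cross_past_pair_whisker:
  assumes "crossing A y x f" "crossing A y' x' h"
    "A \<in> Obj C" "x \<in> Obj C" "y \<in> Obj C" "x' \<in> Obj C" "y' \<in> Obj C"
  shows "cross_past_pair A y y' x x' f h = ai y y' A \<cdot> (Id C y \<boxtimes> h) \<cdot> whisker A y x f x'"
  using assms by (simp add: whisker_def cross_past_pair_def)

lemma cross_pair_arr [simp]: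
  assumes "crossing A y x f" "crossing B x w g"
    "A \<in> Obj C" "B \<in> Obj C" "x \<in> Obj C" "y \<in> Obj C" "w \<in> Obj C"
  shows "cross_pair A B y x w f g \<in> Arr C" "Dom C (cross_pair A B y x w f g) = (A \<otimes> B) \<otimes> w"
    "Cod C (cross_pair A B y x w f g) = y \<otimes> A \<otimes> B"
  using assms by (simp_all add: cross_pair_def)

lemma cross_pair_invertible [simp]:
  assumes "crossing A y x f" "crossing B x w g" "invertible f" "invertible g"
    "A \<in> Obj C" "B \<in> Obj C" "x \<in> Obj C" "y \<in> Obj C" "w \<in> Obj C"
  shows "invertible (cross_pair A B y x w f g)"
  using assms by (simp add: cross_pair_def)

lemma cross_past_pair_arr [simp]:
  assumes "crossing A y x f" "crossing A y' x' h"
    "A \<in> Obj C" "x \<in> Obj C" "y \<in> Obj C" "x' \<in> Obj C" "y' \<in> Obj C"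
  shows "cross_past_pair A y y' x x' f h \<in> Arr C" "Dom C (cross_past_pair A y y' x x' f h) = A \<otimes> x \<otimes> x'"
    "Cod C (cross_past_pair A y y' x x' f h) = (y \<otimes> y') \<otimes> A"
  using assms by (simp_all add: cross_past_pair_def)

lemma whisker_natural:
  assumes "crossing A y x f" "A \<in> Obj C" "x \<in> Obj C" "y \<in> Obj C" "k \<in> Arr C"
  shows "whisker A y x f (Cod C k) \<cdot> (Id C A \<boxtimes> Id C x \<boxtimes> k) = (Id C y \<boxtimes> Id C A \<boxtimes> k) \<cdot>
    whisker A y x f (Dom C k)"
proof -
  have 1: "ai A x (Cod C k) \<cdot> (Id C A \<boxtimes> Id C x \<boxtimes> k) = (Id C (A \<otimes> x) \<boxtimes> k) \<cdot> ai A x (Dom C k)"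
    using ai_nat [of "Id C A" "Id C x" k] assms by simp
  have 2: "(f \<boxtimes> Id C (Cod C k)) \<cdot> (Id C (A \<otimes> x) \<boxtimes> k) = (Id C (y \<otimes> A) \<boxtimes> k) \<cdot> (f \<boxtimes> Id C (Dom C k))"
    using assms by (simp add: tens_comp)
  have 3: "al y A (Cod C k) \<cdot> (Id C (y \<otimes> A) \<boxtimes> k) = (Id C y \<boxtimes> Id C A \<boxtimes> k) \<cdot> al y A (Dom C k)"
    using al_nat [of "Id C y" "Id C A" k] assms by simp
  show ?thesis
    unfolding whisker_def using assms
    by (simp add: 1 reassoc [OF 2] reassoc [OF 3])
qed

text \<open>The pentagon solved for the two composites that arise when a product of crossings is tensored
  with \<open>Z\<close> and rebracketed.\<close>

lemma pentagon_variants: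
  assumes [simp]: "W \<in> Obj C" "X \<in> Obj C" "Y \<in> Obj C" "Z \<in> Obj C"
  shows "al (W \<otimes> X) Y Z \<cdot> (ai W X Y \<boxtimes> Id C Z) =
      ai W X (Y \<otimes> Z) \<cdot> (Id C W \<boxtimes> al X Y Z) \<cdot> al W (X \<otimes> Y) Z" (is ?A)
    and "al W (X \<otimes> Y) Z \<cdot> (al W X Y \<boxtimes> Id C Z) =
      (Id C W \<boxtimes> ai X Y Z) \<cdot> al W X (Y \<otimes> Z) \<cdot> al (W \<otimes> X) Y Z" (is ?B)
proof -
  have i: "invertible (Id C W \<boxtimes> al X Y Z)" "invertible (al W X Y \<boxtimes> Id C Z)" by simp_all
  show ?B
    using inv_arr_cancel(1) [OF i(1), of "al W (X \<otimes> Y) Z \<cdot> (al W X Y \<boxtimes> Id C Z)"]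
    by (simp add: pentagon inv_tens)
  have "al (W \<otimes> X) Y Z = (ai W X (Y \<otimes> Z) \<cdot> (Id C W \<boxtimes> al X Y Z) \<cdot> al W (X \<otimes> Y) Z) \<cdot> (al W X Y \<boxtimes> Id C Z)"
    by (simp add: pentagon)
  then have "al (W \<otimes> X) Y Z \<cdot> (ai W X Y \<boxtimes> Id C Z) =
    ((ai W X (Y \<otimes> Z) \<cdot> (Id C W \<boxtimes> al X Y Z) \<cdot> al W (X \<otimes> Y) Z) \<cdot> (al W X Y \<boxtimes> Id C Z)) \<cdot> (ai W X Y \<boxtimes> Id
      C Z)"
    by (rule arg_cong)
  then show ?A by (simp add: tens_comp)
qed

text \<open>Tensoring the definition of \<open>cross_pair\<close> with \<open>Z\<close> leaves associators of the form
  \<open>\<alpha> \<boxtimes> id\<close>.  Moving the outermost associator from left to right through the composite turns each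
  of them, by the pentagon, into an associator that belongs to one of the two whiskered crossings.\<close>

lemma whisker_cross_pair:
  assumes "crossing A y x f" "crossing B x w g"
    "A \<in> Obj C" "B \<in> Obj C" "x \<in> Obj C" "y \<in> Obj C" "w \<in> Obj C" "Z \<in> Obj C"
  shows "(Id C y \<boxtimes> al A B Z) \<cdot> whisker (A \<otimes> B) y w (cross_pair A B y x w f g) Z =
    whisker A y x f (B \<otimes> Z) \<cdot> (Id C A \<boxtimes> whisker B x w g Z) \<cdot> al A B (w \<otimes> Z)"
proof -
  have f: "al (y \<otimes> A) B Z \<cdot> ((f \<boxtimes> Id C B) \<boxtimes> Id C Z) = (f \<boxtimes> Id C (B \<otimes> Z)) \<cdot> al (A \<otimes> x) B Z"
    using al_nat [of f "Id C B" "Id C Z"] assms by simp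
  have g: "al A (x \<otimes> B) Z \<cdot> ((Id C A \<boxtimes> g) \<boxtimes> Id C Z) = (Id C A \<boxtimes> g \<boxtimes> Id C Z) \<cdot> al A (B \<otimes> w) Z"
    using al_nat [of "Id C A" g "Id C Z"] assms by simp
  have e: "cross_pair A B y x w f g \<boxtimes> Id C Z = (al y A B \<boxtimes> Id C Z) \<cdot> ((f \<boxtimes> Id C B) \<boxtimes> Id C Z) \<cdot>
     (ai A x B \<boxtimes> Id C Z) \<cdot> ((Id C A \<boxtimes> g) \<boxtimes> Id C Z) \<cdot> (al A B w \<boxtimes> Id C Z)"
    using assms by (simp add: cross_pair_def tens_comp)
  have "(Id C y \<boxtimes> al A B Z) \<cdot> whisker (A \<otimes> B) y w (cross_pair A B y x w f g) Z =
     al y A (B \<otimes> Z) \<cdot> al (y \<otimes> A) B Z \<cdot> ((f \<boxtimes> Id C B) \<boxtimes> Id C Z) \<cdot>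
     (ai A x B \<boxtimes> Id C Z) \<cdot> ((Id C A \<boxtimes> g) \<boxtimes> Id C Z) \<cdot> (al A B w \<boxtimes> Id C Z) \<cdot> ai (A \<otimes> B) w Z"
    using assms by (simp add: whisker_def e reassoc [OF pentagon_variants(2)])
  also have "\<dots> = al y A (B \<otimes> Z) \<cdot> (f \<boxtimes> Id C (B \<otimes> Z)) \<cdot> ai A x (B \<otimes> Z) \<cdot> (Id C A \<boxtimes> al x B Z) \<cdot>
    (Id C A \<boxtimes> g \<boxtimes> Id C Z) \<cdot> (Id C A \<boxtimes> ai B w Z) \<cdot> al A B (w \<otimes> Z)"
    using assms by (simp add: reassoc [OF f] reassoc [OF g] reassoc [OF pentagon_variants(1)]
        reassoc [OF pentagon_variants(2)])
  also have "\<dots> = whisker A y x f (B \<otimes> Z) \<cdot> (Id C A \<boxtimes> whisker B x w g Z) \<cdot> al A B (w \<otimes> Z)"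
    using assms by (simp add: whisker_def tens_comp_rest)
  finally show ?thesis .
qed

text \<open>As for \<open>whisker_cross_pair\<close>, the outermost associator travels through the composite and absorbs
  the associators of the form \<open>\<alpha> \<boxtimes> id\<close>.\<close>

lemma whisker_cross_past_pair:
  assumes "crossing A y x f" "crossing A y' x' h"
    "A \<in> Obj C" "x \<in> Obj C" "y \<in> Obj C" "x' \<in> Obj C" "y' \<in> Obj C" "Z \<in> Obj C"
  shows "whisker A (y \<otimes> y') (x \<otimes> x') (cross_past_pair A y y' x x' f h) Z =
    ai y y' (A \<otimes> Z) \<cdot> (Id C y \<boxtimes> whisker A y' x' h Z) \<cdot> whisker A y x f (x' \<otimes> Z) \<cdot> (Id C A \<boxtimes> al x x' Z)"
proof -
  have f: "al (y \<otimes> A) x' Z \<cdot> ((f \<boxtimes> Id C x') \<boxtimes> Id C Z) = (f \<boxtimes> Id C (x' \<otimes> Z)) \<cdot> al (A \<otimes> x) x' Z"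
    using al_nat [of f "Id C x'" "Id C Z"] assms by simp
  have h: "al y (y' \<otimes> A) Z \<cdot> ((Id C y \<boxtimes> h) \<boxtimes> Id C Z) = (Id C y \<boxtimes> h \<boxtimes> Id C Z) \<cdot> al y (A \<otimes> x') Z"
    using al_nat [of "Id C y" h "Id C Z"] assms by simp
  have e: "cross_past_pair A y y' x x' f h \<boxtimes> Id C Z = (ai y y' A \<boxtimes> Id C Z) \<cdot> ((Id C y \<boxtimes> h) \<boxtimes> Id C Z) \<cdot>
     (al y A x' \<boxtimes> Id C Z) \<cdot> ((f \<boxtimes> Id C x') \<boxtimes> Id C Z) \<cdot> (ai A x x' \<boxtimes> Id C Z)"
    using assms by (simp add: cross_past_pair_def tens_comp)
  have "whisker A (y \<otimes> y') (x \<otimes> x') (cross_past_pair A y y' x x' f h) Z =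
     ai y y' (A \<otimes> Z) \<cdot> (Id C y \<boxtimes> al y' A Z) \<cdot> (Id C y \<boxtimes> h \<boxtimes> Id C Z) \<cdot> (Id C y \<boxtimes> ai A x' Z) \<cdot>
     al y A (x' \<otimes> Z) \<cdot> (f \<boxtimes> Id C (x' \<otimes> Z)) \<cdot> ai A x (x' \<otimes> Z) \<cdot> (Id C A \<boxtimes> al x x' Z)"
    using assms by (simp add: whisker_def e reassoc [OF f] reassoc [OF h]
      reassoc [OF pentagon_variants(1)]
        reassoc [OF pentagon_variants(2)])
  also have "\<dots> = ai y y' (A \<otimes> Z) \<cdot> (Id C y \<boxtimes> whisker A y' x' h Z) \<cdot> whisker A y x f (x' \<otimes> Z) \<cdot>
    (Id C A \<boxtimes> al x x' Z)"
    using assms by (simp add: whisker_def tens_comp_rest)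
  finally show ?thesis .
qed

text \<open>Both sides carry \<open>A \<otimes> B\<close> past \<open>w \<otimes> w'\<close> by means of the four crossings; they differ only in the
  order in which \<open>f\<close> and \<open>k\<close> are applied.  These act on disjoint factors and commute, which is the
  naturality of the whiskered \<open>f\<close>.\<close>

lemma interchange:
  assumes "crossing A y x f" "crossing A y' x' h" "crossing B x w g" "crossing B x' w' k"
    "A \<in> Obj C" "B \<in> Obj C" "x \<in> Obj C" "y \<in> Obj C" "x' \<in> Obj C" "y' \<in> Obj C" "w \<in> Obj C" "w' \<in> Obj C"
  shows "cross_pair A B (y \<otimes> y') (x \<otimes> x') (w \<otimes> w') (cross_past_pair A y y' x x' f h)
    (cross_past_pair B x x' w w' g k) =
    cross_past_pair (A \<otimes> B) y y' w w' (cross_pair A B y x w f g) (cross_pair A B y' x' w' h k)"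
proof -
  have n: "whisker A y x f (x' \<otimes> B) \<cdot> (Id C A \<boxtimes> Id C x \<boxtimes> k) = (Id C y \<boxtimes> Id C A \<boxtimes> k) \<cdot>
    whisker A y x f (B \<otimes> w')"
    using whisker_natural [of f A x y k] assms by simp
  have "cross_pair A B (y \<otimes> y') (x \<otimes> x') (w \<otimes> w') (cross_past_pair A y y' x x' f h) (cross_past_pair
    B x x' w w' g k)
    = ai y y' (A \<otimes> B) \<cdot> (Id C y \<boxtimes> whisker A y' x' h B) \<cdot> whisker A y x f (x' \<otimes> B) \<cdot>
      (Id C A \<boxtimes> Id C x \<boxtimes> k) \<cdot> (Id C A \<boxtimes> whisker B x w g w') \<cdot> al A B (w \<otimes> w')"
    using assms by (simp add: cross_pair_whisker [where A = A and y = "y \<otimes> y'"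
      and x = "x \<otimes> x'"] whisker_cross_past_pair cross_past_pair_whisker [where A = B] tens_comp
          tens_comp_rest)
  also have "\<dots> = ai y y' (A \<otimes> B) \<cdot> (Id C y \<boxtimes> whisker A y' x' h B) \<cdot> (Id C y \<boxtimes> Id C A \<boxtimes> k) \<cdot>
     whisker A y x f (B \<otimes> w') \<cdot> (Id C A \<boxtimes> whisker B x w g w') \<cdot> al A B (w \<otimes> w')"
    using assms by (simp add: reassoc [OF n])
  also have "\<dots> = ai y y' (A \<otimes> B) \<cdot> (Id C y \<boxtimes> whisker A y' x' h B) \<cdot> (Id C y \<boxtimes> Id C A \<boxtimes> k) \<cdot>
     (Id C y \<boxtimes> al A B w') \<cdot> whisker (A \<otimes> B) y w (cross_pair A B y x w f g) w'"
    using assms by (simp add: whisker_cross_pair)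
  also have "\<dots> = cross_past_pair (A \<otimes> B) y y' w w' (cross_pair A B y x w f g) (cross_pair A B y' x'
    w' h k)"
    using assms by (simp add: cross_past_pair_whisker [where A = "A \<otimes> B"]
      cross_pair_whisker [where A = A and y = y' and x = x'] tens_comp tens_comp_rest)
  finally show ?thesis .
qed

text \<open>Both sides carry \<open>D\<close>, then \<open>B\<close>, then \<open>A\<close>.  After \<open>whisker_cross_pair\<close> the only difference is in
  the associators on the right, and there it is the pentagon for \<open>A\<close>, \<open>B\<close>, \<open>D\<close>, \<open>v\<close>.\<close>

lemma cross_pair_assoc:
  assumes "crossing A y x f" "crossing B x w g" "crossing D w v k"
    "A \<in> Obj C" "B \<in> Obj C" "D \<in> Obj C" "x \<in> Obj C" "y \<in> Obj C" "w \<in> Obj C" "v \<in> Obj C"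
  shows "(Id C y \<boxtimes> al A B D) \<cdot> cross_pair (A \<otimes> B) D y w v (cross_pair A B y x w f g) k =
    cross_pair A (B \<otimes> D) y x v f (cross_pair B D x w v g k) \<cdot> (al A B D \<boxtimes> Id C v)"
proof -
  have n: "al A B (w \<otimes> D) \<cdot> (Id C (A \<otimes> B) \<boxtimes> k) = (Id C A \<boxtimes> Id C B \<boxtimes> k) \<cdot> al A B (D \<otimes> v)"
    using al_nat [of "Id C A" "Id C B" k] assms by simp
  have "(Id C y \<boxtimes> al A B D) \<cdot> cross_pair (A \<otimes> B) D y w v (cross_pair A B y x w f g) k
    = ((Id C y \<boxtimes> al A B D) \<cdot> whisker (A \<otimes> B) y w (cross_pair A B y x w f g) D) \<cdot> (Id C (A \<otimes> B) \<boxtimes>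
        k) \<cdot> al (A \<otimes> B) D v"
    using assms by (simp add: cross_pair_whisker [where A = "A \<otimes> B"])
  also have "\<dots> = whisker A y x f (B \<otimes> D) \<cdot> (Id C A \<boxtimes> whisker B x w g D) \<cdot> (Id C A \<boxtimes> Id C B \<boxtimes> k) \<cdot>
    al A B (D \<otimes> v) \<cdot> al (A \<otimes> B) D v"
    using assms by (subst whisker_cross_pair) (auto simp: reassoc [OF n])
  also have "al A B (D \<otimes> v) \<cdot> al (A \<otimes> B) D v =
      (Id C A \<boxtimes> al B D v) \<cdot> al A (B \<otimes> D) v \<cdot> (al A B D \<boxtimes> Id C v)"
    using assms by (simp add: pentagon)
  also have "whisker A y x f (B \<otimes> D) \<cdot> (Id C A \<boxtimes> whisker B x w g D) \<cdot> (Id C A \<boxtimes> Id C B \<boxtimes> k) \<cdot> \<dots> =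
    cross_pair A (B \<otimes> D) y x v f (cross_pair B D x w v g k) \<cdot> (al A B D \<boxtimes> Id C v)"
    using assms by (simp add: cross_pair_whisker [where A = A] cross_pair_whisker [where A = B]
      tens_comp_rest)
  finally show ?thesis .
qed

text \<open>Stated for a simultaneous change of all five objects, since each use changes others: naturality
  of a half-braiding changes \<open>w\<close>, \<open>x\<close>, \<open>y\<close>, a morphism of centers changes \<open>A\<close> and \<open>B\<close>, and in the
  proof of admissibility \<open>w\<close>, \<open>x\<close>, \<open>y\<close> are three different representatives of one object of the
  base.\<close>

lemma cross_pair_natural:
  assumes "crossing A y x f" "crossing B x w g" "crossing A' y' x' f'" "crossing B' x' w' g'"
    "u \<in> hom C A A'" "v \<in> hom C B B'" "s \<in> hom C y y'" "r \<in> hom C x x'" "t \<in> hom C w w'"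
    and f: "(s \<boxtimes> u) \<cdot> f = f' \<cdot> (u \<boxtimes> r)" and g: "(r \<boxtimes> v) \<cdot> g = g' \<cdot> (v \<boxtimes> t)"
  shows "(s \<boxtimes> u \<boxtimes> v) \<cdot> cross_pair A B y x w f g = cross_pair A' B' y' x' w' f' g' \<cdot> ((u \<boxtimes> v) \<boxtimes> t)"
proof -
  note [simp] = assms(1-4)
  have [simp]: "A \<in> Obj C" "B \<in> Obj C" "x \<in> Obj C" "y \<in> Obj C" "w \<in> Obj C"
      "A' \<in> Obj C" "B' \<in> Obj C" "x' \<in> Obj C" "y' \<in> Obj C" "w' \<in> Obj C"
    using assms(5-9) hom_obD by blast+
  have [simp]: "u \<in> Arr C" "Dom C u = A" "Cod C u = A'" "v \<in> Arr C" "Dom C v = B" "Cod C v = B'"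
      "s \<in> Arr C" "Dom C s = y" "Cod C s = y'" "r \<in> Arr C" "Dom C r = x" "Cod C r = x'"
      "t \<in> Arr C" "Dom C t = w" "Cod C t = w'"
    using assms(5-9) homD by blast+
  have 1: "(s \<boxtimes> u \<boxtimes> v) \<cdot> al y A B = al y' A' B' \<cdot> ((s \<boxtimes> u) \<boxtimes> v)"
    using al_nat [of s u v] by simp
  have 2: "((s \<boxtimes> u) \<boxtimes> v) \<cdot> (f \<boxtimes> Id C B) = (f' \<boxtimes> Id C B') \<cdot> ((u \<boxtimes> r) \<boxtimes> v)"
    by (simp add: tens_comp f)
  have 3: "((u \<boxtimes> r) \<boxtimes> v) \<cdot> ai A x B = ai A' x' B' \<cdot> (u \<boxtimes> r \<boxtimes> v)"
    using ai_nat [of u r v] by simp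
  have 4: "(u \<boxtimes> r \<boxtimes> v) \<cdot> (Id C A \<boxtimes> g) = (Id C A' \<boxtimes> g') \<cdot> (u \<boxtimes> v \<boxtimes> t)"
    by (simp add: tens_comp g)
  have 5: "(u \<boxtimes> v \<boxtimes> t) \<cdot> al A B w = al A' B' w' \<cdot> ((u \<boxtimes> v) \<boxtimes> t)"
    using al_nat [of u v t] by simp
  show ?thesis
    unfolding cross_pair_def
    by (simp add: reassoc [OF 1] reassoc [OF 2] reassoc [OF 3] reassoc [OF 4] 5)
qed

lemma cross_pair_unit_left:
  assumes "crossing B y w g" "B \<in> Obj C" "y \<in> Obj C" "w \<in> Obj C"
  shows "cross_pair (Unit C) B y y w (Id C y) g = g"
  using assms by (simp add: cross_pair_def unit_obj unit_left_ob unit_right_ob unit_left_ar triangle)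

lemma cross_pair_unit_right:
  assumes "crossing A y x f" "A \<in> Obj C" "x \<in> Obj C" "y \<in> Obj C"
  shows "cross_pair A (Unit C) y x x f (Id C x) = f"
  using assms by (simp add: cross_pair_def unit_obj unit_left_ob unit_right_ob unit_right_ar triangle)

lemma cross_past_pair_unit:
  assumes "x \<in> Obj C" "y \<in> Obj C"
  shows "cross_past_pair (Unit C) x y x y (Id C x) (Id C y) = Id C (x \<otimes> y)"
  using assms by (simp add: cross_past_pair_def unit_obj unit_left_ob unit_right_ob triangle)

end

section \<open>Braidings are crossings\<close>

context braided_monoidal_category
begin

lemma psi_simps [simp]:
  assumes "X \<in> Obj C" "Y \<in> Obj C"
  shows "Psi X Y \<in> Arr C" "Dom C (Psi X Y) = X \<otimes> Y" "Cod C (Psi X Y) = Y \<otimes> X" "invertible (Psi X Y)"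
  using isoD [OF braiding_iso [OF assms]] by auto

lemma psi_natural:
  assumes "f \<in> Arr C" "g \<in> Arr C"
  shows "(g \<boxtimes> f) \<cdot> Psi (Dom C f) (Dom C g) = Psi (Cod C f) (Cod C g) \<cdot> (f \<boxtimes> g)"
  using braiding_natural [of f "Dom C f" "Cod C f" g "Dom C g" "Cod C g"] assms by (simp add: hom_def)

text \<open>The second hexagon axiom with its outer associators moved to the other side.\<close>

lemma psi_cross_pair:
  assumes [simp]: "X \<in> Obj C" "Y \<in> Obj C" "Z \<in> Obj C"
  shows "Psi (X \<otimes> Y) Z = cross_pair X Y Z Z Z (Psi X Z) (Psi Y Z)"
proof -
  have "cross_pair X Y Z Z Z (Psi X Z) (Psi Y Z) =
    al Z X Y \<cdot> ((Psi X Z \<boxtimes> Id C Y) \<cdot> ai X Z Y \<cdot> (Id C X \<boxtimes> Psi Y Z)) \<cdot> al X Y Z"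
    by (simp add: cross_pair_def)
  also have "\<dots> = Psi (X \<otimes> Y) Z"
    by (simp add: hexagon2 [symmetric])
  finally show ?thesis by simp
qed

text \<open>By \<open>psi_cross_pair\<close> for two units this braiding is idempotent, and it is invertible.\<close>

lemma psi_unit_left:
  assumes [simp]: "X \<in> Obj C"
  shows "Psi (Unit C) X = Id C X"
proof -
  note [simp] = unit_obj unit_left_ob unit_right_ob unit_left_ar unit_right_ar triangle
  have "Psi (Unit C) X \<cdot> Psi (Unit C) X = Psi (Unit C) X"
    using psi_cross_pair [of "Unit C" "Unit C" X] by (simp add: cross_pair_def)
  then have "Psi (Unit C) X \<cdot> Psi (Unit C) X = Psi (Unit C) X \<cdot> Id C X" by simp
  then show ?thesis by (rule cancel_left [rotated]) auto
qed

end

section \<open>Monoidal functors and crossings\<close>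

context monoidal_functor
begin

lemma ob_G [simp]: "X \<in> Obj C \<Longrightarrow> ob G X \<in> Obj D"
  by (rule ob_obj)

lemma ar_G [simp]:
  assumes "f \<in> Arr C"
  shows "ar G f \<in> Arr D" "Dom D (ar G f) = ob G (Dom C f)" "Cod D (ar G f) = ob G (Cod C f)"
  using ar_hom [of f "Dom C f" "Cod C f"] assms by (auto simp: hom_def)

declare ar_id [simp]

lemma ar_G_comp [simp]:
  assumes "f \<in> Arr C" "g \<in> Arr C" "Dom C g = Cod C f"
  shows "ar G (g \<cdot>\<^bsub>C\<^esub> f) = ar G g \<cdot>\<^bsub>D\<^esub> ar G f"
  using ar_comp [of f "Dom C f" "Cod C f" g "Cod C g"] assms by (simp add: hom_def)

lemma invertible_ar [simp]:
  assumes "source.invertible f"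
  shows "target.invertible (ar G f)" "ar G (inv_arr C f) = inv_arr D (ar G f)"
proof -
  have f: "f \<in> Arr C" using assms by (rule source.invertible_arr)
  have *: "ar G (inv_arr C f) \<cdot>\<^bsub>D\<^esub> ar G f = Id D (ob G (Dom C f))"
    "ar G f \<cdot>\<^bsub>D\<^esub> ar G (inv_arr C f) = Id D (ob G (Cod C f))"
    using f assms by (simp_all flip: ar_G_comp)
  show "target.invertible (ar G f)"
    using f assms * by (intro target.invertibleI(1) [where g = "ar G (inv_arr C f)"]) auto
  show "ar G (inv_arr C f) = inv_arr D (ar G f)"
    using f assms * by (intro target.invertibleI(2) [symmetric]) auto
qed

lemma mu_simps [simp]:
  assumes "X \<in> Obj C" "Y \<in> Obj C"
  shows "target.invertible (Mu G X Y)" "Mu G X Y \<in> Arr D" "Dom D (Mu G X Y) = ob G (X \<otimes>\<^bsub>C\<^esub> Y)"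
    "Cod D (Mu G X Y) = ob G X \<otimes>\<^bsub>D\<^esub> ob G Y"
  using target.isoD [OF mu_iso [OF assms]] by auto

lemma mu_nat:
  assumes "f \<in> Arr C" "g \<in> Arr C"
  shows "Mu G (Cod C f) (Cod C g) \<cdot>\<^bsub>D\<^esub> ar G (f \<boxtimes>\<^bsub>C\<^esub> g) = (ar G f \<boxtimes>\<^bsub>D\<^esub> ar G g) \<cdot>\<^bsub>D\<^esub>
    Mu G (Dom C f) (Dom C g)"
  using mu_natural [of f "Dom C f" "Cod C f" g "Dom C g" "Cod C g"] assms by (simp add: hom_def)

definition transport where
  "transport A y x f = Mu G y A \<cdot>\<^bsub>D\<^esub> ar G f \<cdot>\<^bsub>D\<^esub> inv_arr D (Mu G A x)"

lemma transport_arr [simp]: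
  assumes "source.crossing A y x f" "A \<in> Obj C" "x \<in> Obj C" "y \<in> Obj C"
  shows "transport A y x f \<in> Arr D" "Dom D (transport A y x f) = ob G A \<otimes>\<^bsub>D\<^esub> ob G x"
    "Cod D (transport A y x f) = ob G y \<otimes>\<^bsub>D\<^esub> ob G A"
  using assms by (simp_all add: transport_def)

text \<open>The coherence of \<open>Mu\<close> with the associators is used once for each of the three associators in
  \<open>cross_pair\<close>, and its naturality once for each of the two crossings.\<close>

lemma transport_cross_pair:
  assumes "source.crossing A y x f" "source.crossing B x w g"
    and [simp]: "A \<in> Obj C" "B \<in> Obj C" "x \<in> Obj C" "y \<in> Obj C" "w \<in> Obj C"
  shows "(Id D (ob G y) \<boxtimes>\<^bsub>D\<^esub> Mu G A B) \<cdot>\<^bsub>D\<^esub> transport (A \<otimes>\<^bsub>C\<^esub> B) y w (source.cross_pair A B y x w f g) =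
    target.cross_pair (ob G A) (ob G B) (ob G y) (ob G x) (ob G w) (transport A y x f) (transport B
        x w g) \<cdot>\<^bsub>D\<^esub>
    (Mu G A B \<boxtimes>\<^bsub>D\<^esub> Id D (ob G w))"
proof -
  have [simp]: "f \<in> Arr C" "Dom C f = A \<otimes>\<^bsub>C\<^esub> x" "Cod C f = y \<otimes>\<^bsub>C\<^esub> A"
    "g \<in> Arr C" "Dom C g = B \<otimes>\<^bsub>C\<^esub> w" "Cod C g = x \<otimes>\<^bsub>C\<^esub> B"
    using assms by auto
  have f: "Mu G (y \<otimes>\<^bsub>C\<^esub> A) B \<cdot>\<^bsub>D\<^esub> ar G (f \<boxtimes>\<^bsub>C\<^esub> Id C B) =
      (ar G f \<boxtimes>\<^bsub>D\<^esub> Id D (ob G B)) \<cdot>\<^bsub>D\<^esub> Mu G (A \<otimes>\<^bsub>C\<^esub> x) B"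
    using mu_nat [of f "Id C B"] by simp
  have g: "Mu G A (x \<otimes>\<^bsub>C\<^esub> B) \<cdot>\<^bsub>D\<^esub> ar G (Id C A \<boxtimes>\<^bsub>C\<^esub> g) =
      (Id D (ob G A) \<boxtimes>\<^bsub>D\<^esub> ar G g) \<cdot>\<^bsub>D\<^esub> Mu G A (B \<otimes>\<^bsub>C\<^esub> w)"
    using mu_nat [of "Id C A" g] by simp
  \<comment> \<open>The axiom \<open>mu_assoc\<close> solved for the inverse associator in the middle of \<open>cross_pair\<close>.\<close>
  have i: "Mu G (X \<otimes>\<^bsub>C\<^esub> Y) Z' \<cdot>\<^bsub>D\<^esub> inv_arr D (ar G (Assoc C X Y Z')) =
     (inv_arr D (Mu G X Y) \<boxtimes>\<^bsub>D\<^esub> Id D (ob G Z')) \<cdot>\<^bsub>D\<^esub> inv_arr D (Assoc D (ob G X) (ob G Y)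
       (ob G Z')) \<cdot>\<^bsub>D\<^esub>
      (Id D (ob G X) \<boxtimes>\<^bsub>D\<^esub> Mu G Y Z') \<cdot>\<^bsub>D\<^esub> Mu G X (Y \<otimes>\<^bsub>C\<^esub> Z')"
    if [simp]: "X \<in> Obj C" "Y \<in> Obj C" "Z' \<in> Obj C" for X Y Z'
  proof (rule target.cancel_right [where f = "ar G (Assoc C X Y Z')"])
    show "(Mu G (X \<otimes>\<^bsub>C\<^esub> Y) Z' \<cdot>\<^bsub>D\<^esub> inv_arr D (ar G (Assoc C X Y Z'))) \<cdot>\<^bsub>D\<^esub> ar G (Assoc C X Y Z') =
     ((inv_arr D (Mu G X Y) \<boxtimes>\<^bsub>D\<^esub> Id D (ob G Z')) \<cdot>\<^bsub>D\<^esub> inv_arr D (Assoc D (ob G X) (ob G Y)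
       (ob G Z')) \<cdot>\<^bsub>D\<^esub>
      (Id D (ob G X) \<boxtimes>\<^bsub>D\<^esub> Mu G Y Z') \<cdot>\<^bsub>D\<^esub> Mu G X (Y \<otimes>\<^bsub>C\<^esub> Z')) \<cdot>\<^bsub>D\<^esub> ar G (Assoc C X Y Z')"
      by (simp add: mu_assoc)
  qed simp_all
  \<comment> \<open>The same axiom solved for the rightmost associator, next to the inverse of \<open>Mu\<close> from
    \<open>transport\<close>.\<close>
  have j: "Mu G A (B \<otimes>\<^bsub>C\<^esub> w) \<cdot>\<^bsub>D\<^esub> ar G (Assoc C A B w) \<cdot>\<^bsub>D\<^esub> inv_arr D (Mu G (A \<otimes>\<^bsub>C\<^esub> B) w) =
     (Id D (ob G A) \<boxtimes>\<^bsub>D\<^esub> inv_arr D (Mu G B w)) \<cdot>\<^bsub>D\<^esub> Assoc D (ob G A) (ob G B) (ob G w) \<cdot>\<^bsub>D\<^esub>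
     (Mu G A B \<boxtimes>\<^bsub>D\<^esub> Id D (ob G w))"
  proof (rule target.cancel_left [where f = "Id D (ob G A) \<boxtimes>\<^bsub>D\<^esub> Mu G B w"])
    have "(Id D (ob G A) \<boxtimes>\<^bsub>D\<^esub> Mu G B w) \<cdot>\<^bsub>D\<^esub> Mu G A (B \<otimes>\<^bsub>C\<^esub> w) \<cdot>\<^bsub>D\<^esub> ar G (Assoc C A B w) \<cdot>\<^bsub>D\<^esub>
      inv_arr D (Mu G (A \<otimes>\<^bsub>C\<^esub> B) w)
      = ((Id D (ob G A) \<boxtimes>\<^bsub>D\<^esub> Mu G B w) \<cdot>\<^bsub>D\<^esub> Mu G A (B \<otimes>\<^bsub>C\<^esub> w) \<cdot>\<^bsub>D\<^esub> ar G (Assoc C A B w)) \<cdot>\<^bsub>D\<^esub>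
          inv_arr D (Mu G (A \<otimes>\<^bsub>C\<^esub> B) w)"
      by simp
    also have "\<dots> = (Id D (ob G A) \<boxtimes>\<^bsub>D\<^esub> Mu G B w) \<cdot>\<^bsub>D\<^esub> (Id D (ob G A) \<boxtimes>\<^bsub>D\<^esub> inv_arr D (Mu G B w)) \<cdot>\<^bsub>D\<^esub>
      Assoc D (ob G A) (ob G B) (ob G w) \<cdot>\<^bsub>D\<^esub>
     (Mu G A B \<boxtimes>\<^bsub>D\<^esub> Id D (ob G w))"
      unfolding mu_assoc [OF assms(3,4,7)] by simp
    finally show "(Id D (ob G A) \<boxtimes>\<^bsub>D\<^esub> Mu G B w) \<cdot>\<^bsub>D\<^esub> Mu G A (B \<otimes>\<^bsub>C\<^esub> w) \<cdot>\<^bsub>D\<^esub>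
        ar G (Assoc C A B w) \<cdot>\<^bsub>D\<^esub> inv_arr D (Mu G (A \<otimes>\<^bsub>C\<^esub> B) w)
      = (Id D (ob G A) \<boxtimes>\<^bsub>D\<^esub> Mu G B w) \<cdot>\<^bsub>D\<^esub> (Id D (ob G A) \<boxtimes>\<^bsub>D\<^esub> inv_arr D (Mu G B w)) \<cdot>\<^bsub>D\<^esub> Assoc D
          (ob G A) (ob G B) (ob G w) \<cdot>\<^bsub>D\<^esub>
     (Mu G A B \<boxtimes>\<^bsub>D\<^esub> Id D (ob G w))" .
  qed simp_all
  have "(Id D (ob G y) \<boxtimes>\<^bsub>D\<^esub> Mu G A B) \<cdot>\<^bsub>D\<^esub> transport (A \<otimes>\<^bsub>C\<^esub> B) y w (source.cross_pair A B y x w f g) =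
    ((Id D (ob G y) \<boxtimes>\<^bsub>D\<^esub> Mu G A B) \<cdot>\<^bsub>D\<^esub> Mu G y (A \<otimes>\<^bsub>C\<^esub> B) \<cdot>\<^bsub>D\<^esub> ar G (Assoc C y A B)) \<cdot>\<^bsub>D\<^esub>
     ar G (f \<boxtimes>\<^bsub>C\<^esub> Id C B) \<cdot>\<^bsub>D\<^esub> inv_arr D (ar G (Assoc C A x B)) \<cdot>\<^bsub>D\<^esub> ar G (Id C A \<boxtimes>\<^bsub>C\<^esub> g) \<cdot>\<^bsub>D\<^esub>
     ar G (Assoc C A B w) \<cdot>\<^bsub>D\<^esub> inv_arr D (Mu G (A \<otimes>\<^bsub>C\<^esub> B) w)"
    by (simp add: transport_def source.cross_pair_def)
  also have "\<dots> = Assoc D (ob G y) (ob G A) (ob G B) \<cdot>\<^bsub>D\<^esub> (Mu G y A \<boxtimes>\<^bsub>D\<^esub> Id D (ob G B)) \<cdot>\<^bsub>D\<^esub>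
      (ar G f \<boxtimes>\<^bsub>D\<^esub> Id D (ob G B)) \<cdot>\<^bsub>D\<^esub>
      (inv_arr D (Mu G A x) \<boxtimes>\<^bsub>D\<^esub> Id D (ob G B)) \<cdot>\<^bsub>D\<^esub> inv_arr D (Assoc D (ob G A) (ob G x) (ob G B)) \<cdot>\<^bsub>D\<^esub>
      (Id D (ob G A) \<boxtimes>\<^bsub>D\<^esub> Mu G x B) \<cdot>\<^bsub>D\<^esub> (Id D (ob G A) \<boxtimes>\<^bsub>D\<^esub> ar G g) \<cdot>\<^bsub>D\<^esub>
      (Id D (ob G A) \<boxtimes>\<^bsub>D\<^esub> inv_arr D (Mu G B w)) \<cdot>\<^bsub>D\<^esub> Assoc D (ob G A) (ob G B) (ob G w) \<cdot>\<^bsub>D\<^esub>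
     (Mu G A B \<boxtimes>\<^bsub>D\<^esub> Id D (ob G w))"
    unfolding mu_assoc [OF assms(6,3,4)]
    by (simp add: target.reassoc [OF f] target.reassoc [OF g] target.reassoc [OF i] j)
  also have "\<dots> = target.cross_pair (ob G A) (ob G B) (ob G y) (ob G x) (ob G w) (transport A y x f)
    (transport B x w g) \<cdot>\<^bsub>D\<^esub>
    (Mu G A B \<boxtimes>\<^bsub>D\<^esub> Id D (ob G w))"
    by (simp add: transport_def target.cross_pair_def target.tens_comp_rest)
  finally show ?thesis .
qed

lemma inv_mu_unit:
  assumes [simp]: "X \<in> Obj C"
  shows "inv_arr D (Mu G (Unit C) X) = Eps G \<boxtimes>\<^bsub>D\<^esub> Id D (ob G X)"
proof -
  note [simp] = source.unit_obj target.unit_obj source.unit_left_ob target.unit_left_ob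
  have e [simp]: "Eps G \<in> Arr D" "Dom D (Eps G) = ob G (Unit C)" "Cod D (Eps G) = Unit D"
    using target.isoD [OF eps_iso] by auto
  show ?thesis
  proof (rule target.cancel_right [where f = "Mu G (Unit C) X"])
    show "inv_arr D (Mu G (Unit C) X) \<cdot>\<^bsub>D\<^esub> Mu G (Unit C) X = (Eps G \<boxtimes>\<^bsub>D\<^esub> Id D (ob G X)) \<cdot>\<^bsub>D\<^esub>
      Mu G (Unit C) X"
      by (simp add: mu_unit_left)
  qed simp_all
qed

end

section \<open>Products of categories\<close>

lemma hom_prod_cat: "hom (prod_cat C D) (X, X') (Y, Y') = hom C X Y \<times> hom D X' Y'"
  by (auto simp: hom_def prod_cat_def)

lemma prod_cat_simps [simp]:
  "Obj (prod_cat C D) = Obj C \<times> Obj D" "Arr (prod_cat C D) = Arr C \<times> Arr D"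
  "Dom (prod_cat C D) (f, f') = (Dom C f, Dom D f')" "Cod (prod_cat C D) (f, f') = (Cod C f, Cod D f')"
  "Id (prod_cat C D) (X, X') = (Id C X, Id D X')"
  "Comp (prod_cat C D) (g, g') (f, f') = (Comp C g f, Comp D g' f')"
  by (simp_all add: prod_cat_def)

lemma category_prod_cat:
  assumes "category C" "category D"
  shows "category (prod_cat C D)"
proof -
  interpret C: category C by fact
  interpret D: category D by fact
  show ?thesis by unfold_locales (auto simp: hom_def)
qed

section \<open>Half-braidings and admissibility as equations of crossings\<close>

text \<open>The part of the relative setting that does not single out functors on \<open>M\<close>, so that the functors
  \<open>G\<^sub>1\<close>, \<open>G\<^sub>2\<close>, \<open>G\<^sub>3\<close> can vary.\<close>

locale center_setting =
  V: monoidal_category V + M: monoidal_category M +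
  B: braided_monoidal_category B Psi + F': monoidal_functor V B F'
  for V :: "('vo, 'va) moncat" (structure) and M :: "('mo, 'ma) moncat"
    and B :: "('bo, 'ba) moncat" and Psi :: "'bo \<Rightarrow> 'bo \<Rightarrow> 'ba"
    and F' :: "('vo, 'va, 'bo, 'ba) monfunc" +
  fixes P :: "('bo, 'ba, 'mo, 'ma) monfunc" and tau :: "'bo \<Rightarrow> 'ba"
  assumes P_ob [simp]: "X \<in> Obj B \<Longrightarrow> ob P X \<in> Obj M"
begin

abbreviation comparison :: "('mo \<Rightarrow> 'ba) \<Rightarrow> 'bo \<Rightarrow> 'ba" where
  "comparison th X \<equiv> tau X \<cdot>\<^bsub>B\<^esub> th (ob P X)"

text \<open>What a half-braiding sees of a strong monoidal functor: its values and the isomorphisms \<open>Mu\<close>.\<close>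

definition strong_functor :: "('mo, 'ma, 'vo, 'va) monfunc \<Rightarrow> bool" where
  "strong_functor K \<longleftrightarrow>
    (\<forall>X\<in>Obj M. ob K X \<in> Obj V) \<and>
    (\<forall>f\<in>Arr M. ar K f \<in> hom V (ob K (Dom M f)) (ob K (Cod M f))) \<and>
    (\<forall>X\<in>Obj M. \<forall>Y\<in>Obj M. Mu K X Y \<in> iso V (ob K (X \<otimes>\<^bsub>M\<^esub> Y)) (ob K X \<otimes> ob K Y))"

text \<open>The last condition makes \<open>F'KP(X)\<close> a copy of \<open>X\<close>, as admissibility requires.\<close>

definition over_base_functor :: "('mo, 'ma, 'vo, 'va) monfunc \<Rightarrow> ('mo \<Rightarrow> 'ba) \<Rightarrow> bool" where
  "over_base_functor K th \<longleftrightarrow> strong_functor K \<and>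
    (\<forall>X\<in>Obj B. comparison th X \<in> iso B (ob F' (ob K (ob P X))) X)"

lemma strong_functor_simps [simp]:
  assumes "strong_functor K"
  shows "X \<in> Obj M \<Longrightarrow> ob K X \<in> Obj V"
    "f \<in> Arr M \<Longrightarrow> ar K f \<in> Arr V"
    "f \<in> Arr M \<Longrightarrow> Dom V (ar K f) = ob K (Dom M f)"
    "f \<in> Arr M \<Longrightarrow> Cod V (ar K f) = ob K (Cod M f)"
    "X \<in> Obj M \<Longrightarrow> Y \<in> Obj M \<Longrightarrow> V.invertible (Mu K X Y)"
    "X \<in> Obj M \<Longrightarrow> Y \<in> Obj M \<Longrightarrow> Mu K X Y \<in> Arr V"
    "X \<in> Obj M \<Longrightarrow> Y \<in> Obj M \<Longrightarrow> Dom V (Mu K X Y) = ob K (X \<otimes>\<^bsub>M\<^esub> Y)"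
    "X \<in> Obj M \<Longrightarrow> Y \<in> Obj M \<Longrightarrow> Cod V (Mu K X Y) = ob K X \<otimes> ob K Y"
  using assms V.isoD unfolding strong_functor_def hom_def by blast+

lemma over_base_strong: "over_base_functor K th \<Longrightarrow> strong_functor K"
  by (simp add: over_base_functor_def)

lemma over_base_comparison:
  assumes "over_base_functor K th" "X \<in> Obj B"
  shows "B.invertible (comparison th X) \<and> comparison th X \<in> Arr B \<and>
     Dom B (comparison th X) = ob F' (ob K (ob P X)) \<and> Cod B (comparison th X) = X"
  using assms B.isoD unfolding over_base_functor_def by blast

abbreviation Mixed where "Mixed G1 th1 G2 th2 \<equiv> mixed_center B Psi M P tau V F' G1 th1 G2 th2"

text \<open>The tensor-compatibility of a half-braiding, freed of the inverse of \<open>Mu\<close>, says that the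
  component at \<open>X \<otimes> Y\<close> is, up to \<open>Mu\<close>, the pasting of the components at \<open>X\<close> and \<open>Y\<close>.\<close>

lemma half_braiding_iff:
  assumes [simp]: "strong_functor G1" "strong_functor G2" "A \<in> Obj V"
  shows "half_braiding M V G1 G2 A c \<longleftrightarrow>
    c \<in> extensional (Obj M) \<and>
    (\<forall>X\<in>Obj M. V.crossing A (ob G1 X) (ob G2 X) (c X) \<and> V.invertible (c X)) \<and>
    (\<forall>f\<in>Arr M. (ar G1 f \<boxtimes> Id V A) \<cdot> c (Dom M f) = c (Cod M f) \<cdot> (Id V A \<boxtimes> ar G2 f)) \<and>
    (\<forall>X\<in>Obj M. \<forall>Y\<in>Obj M. (Mu G1 X Y \<boxtimes> Id V A) \<cdot> c (X \<otimes>\<^bsub>M\<^esub> Y) =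
       V.cross_past_pair A (ob G1 X) (ob G1 Y) (ob G2 X) (ob G2 Y) (c X) (c Y) \<cdot> (Id V A \<boxtimes> Mu G2 X Y))"
proof -
  have iso: "c X \<in> iso V (A \<otimes> ob G2 X) (ob G1 X \<otimes> A) \<longleftrightarrow>
     V.crossing A (ob G1 X) (ob G2 X) (c X) \<and> V.invertible (c X)" if "X \<in> Obj M" for X
    using V.isoD V.isoI by blast
  have nat: "(\<forall>X\<in>Obj M. \<forall>Y\<in>Obj M. \<forall>f\<in>hom M X Y. (ar G1 f \<boxtimes> Id V A) \<cdot> c X = c Y \<cdot> (Id V A \<boxtimes> ar G2 f)) \<longleftrightarrow>
     (\<forall>f\<in>Arr M. (ar G1 f \<boxtimes> Id V A) \<cdot> c (Dom M f) = c (Cod M f) \<cdot> (Id V A \<boxtimes> ar G2 f))"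
    by (auto simp: hom_def)
  have mu: "c (X \<otimes>\<^bsub>M\<^esub> Y) =
        (inv_arr V (Mu G1 X Y) \<boxtimes> Id V A) \<cdot> inv_arr V (Assoc V (ob G1 X) (ob G1 Y) A) \<cdot>
        (Id V (ob G1 X) \<boxtimes> c Y) \<cdot> Assoc V (ob G1 X) A (ob G2 Y) \<cdot> (c X \<boxtimes> Id V (ob G2 Y)) \<cdot>
        inv_arr V (Assoc V A (ob G2 X) (ob G2 Y)) \<cdot> (Id V A \<boxtimes> Mu G2 X Y) \<longleftrightarrow>
     (Mu G1 X Y \<boxtimes> Id V A) \<cdot> c (X \<otimes>\<^bsub>M\<^esub> Y) =
       V.cross_past_pair A (ob G1 X) (ob G1 Y) (ob G2 X) (ob G2 Y) (c X) (c Y) \<cdot> (Id V A \<boxtimes> Mu G2 X Y)"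
    (is "?l = ?r \<longleftrightarrow> _ = ?r'")
    if cr: "\<forall>X\<in>Obj M. V.crossing A (ob G1 X) (ob G2 X) (c X) \<and> V.invertible (c X)"
      and [simp]: "X \<in> Obj M" "Y \<in> Obj M" for X Y
  proof -
    have r: "?r = (inv_arr V (Mu G1 X Y) \<boxtimes> Id V A) \<cdot> ?r'"
      using cr by (simp add: V.cross_past_pair_def)
    show ?thesis
    proof
      assume "?l = ?r"
      then have "?l = (inv_arr V (Mu G1 X Y) \<boxtimes> Id V A) \<cdot> ?r'" by (simp only: r)
      then show "(Mu G1 X Y \<boxtimes> Id V A) \<cdot> ?l = ?r'"
        using cr by simp
    next
      assume "(Mu G1 X Y \<boxtimes> Id V A) \<cdot> ?l = ?r'"
      then have "(inv_arr V (Mu G1 X Y) \<boxtimes> Id V A) \<cdot> (Mu G1 X Y \<boxtimes> Id V A) \<cdot> ?l = ?r"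
        by (simp only: r)
      then show "?l = ?r"
        using cr by simp
    qed
  qed
  show ?thesis
    unfolding half_braiding_def using iso nat mu by (auto simp del: V.comp_assoc_arr)
qed

text \<open>Admissibility, freed of inverses, says that the comparison isomorphisms form a commutative
  square from the transported crossing to the braiding.  In this form it matches the hypotheses of
  \<open>cross_pair_natural\<close>.\<close>

lemma admissible_iff:
  assumes l: "over_base_functor G1 th1" "over_base_functor G2 th2" and [simp]: "A \<in> Obj V"
    and c: "\<And>X. X \<in> Obj M \<Longrightarrow> V.crossing A (ob G1 X) (ob G2 X) (c X)"
  shows "admissible B Psi P F' G1 (comparison th1) G2 (comparison th2) A c \<longleftrightarrow>
    (\<forall>X\<in>Obj B. (comparison th1 X \<boxtimes>\<^bsub>B\<^esub> Id B (ob F' A)) \<cdot>\<^bsub>B\<^esub>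
        F'.transport A (ob G1 (ob P X)) (ob G2 (ob P X)) (c (ob P X)) =
       Psi (ob F' A) X \<cdot>\<^bsub>B\<^esub> (Id B (ob F' A) \<boxtimes>\<^bsub>B\<^esub> comparison th2 X))"
proof -
  note [simp] = l [THEN over_base_strong]
  have "(s1 \<boxtimes>\<^bsub>B\<^esub> Id B (ob F' A)) \<cdot>\<^bsub>B\<^esub> Mu F' (ob G1 (ob P X)) A \<cdot>\<^bsub>B\<^esub> ar F' (c (ob P X)) \<cdot>\<^bsub>B\<^esub>
        inv_arr B (Mu F' A (ob G2 (ob P X))) \<cdot>\<^bsub>B\<^esub> (Id B (ob F' A) \<boxtimes>\<^bsub>B\<^esub> inv_arr B s2) = Psi (ob F' A) X \<longleftrightarrow>
    (s1 \<boxtimes>\<^bsub>B\<^esub> Id B (ob F' A)) \<cdot>\<^bsub>B\<^esub>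
        F'.transport A (ob G1 (ob P X)) (ob G2 (ob P X)) (c (ob P X)) =
       Psi (ob F' A) X \<cdot>\<^bsub>B\<^esub> (Id B (ob F' A) \<boxtimes>\<^bsub>B\<^esub> s2)" (is "?l = ?p \<longleftrightarrow> ?t = ?q")
    if s1_def: "s1 = comparison th1 X" and s2_def: "s2 = comparison th2 X" and [simp]: "X \<in> Obj B"
        for X s1 s2
  proof -
    let ?j = "Id B (ob F' A) \<boxtimes>\<^bsub>B\<^esub> inv_arr B s2"
    have [simp]: "B.invertible s1" "s1 \<in> Arr B" "Dom B s1 = ob F' (ob G1 (ob P X))" "Cod B s1 = X"
        "B.invertible s2" "s2 \<in> Arr B" "Dom B s2 = ob F' (ob G2 (ob P X))" "Cod B s2 = X"
      unfolding s1_def s2_def using over_base_comparison [OF l(1), of X]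
        over_base_comparison [OF l(2), of X] that(3) by blast+
    have c' [simp]: "c (ob P X) \<in> Arr V" "Dom V (c (ob P X)) = A \<otimes> ob G2 (ob P X)"
      "Cod V (c (ob P X)) = ob G1 (ob P X) \<otimes> A" using c [of "ob P X"] by simp_all
    have l: "?l = ?t \<cdot>\<^bsub>B\<^esub> ?j"
      by (simp add: F'.transport_def)
    have q: "?p = ?q \<cdot>\<^bsub>B\<^esub> ?j"
      by (simp add: B.tens_comp)
    show ?thesis
    proof
      assume "?l = ?p"
      then have "?t \<cdot>\<^bsub>B\<^esub> ?j = ?q \<cdot>\<^bsub>B\<^esub> ?j" by (simp only: l q [symmetric])
      then show "?t = ?q" by (rule B.cancel_right [rotated]) auto
    next
      assume "?t = ?q"
      then have "?t \<cdot>\<^bsub>B\<^esub> ?j = ?q \<cdot>\<^bsub>B\<^esub> ?j" by (rule arg_cong)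
      then show "?l = ?p" by (simp only: l q [symmetric])
    qed
  qed
  then show ?thesis by (simp add: admissible_def)
qed

section \<open>Mixed relative centers as categories\<close>

lemma mixed_simps [simp]:
  "Dom (Mixed G1 th1 G2 th2) (x, t, y) = x" "Cod (Mixed G1 th1 G2 th2) (x, t, y) = y"
  "Id (Mixed G1 th1 G2 th2) x = (x, Id V (fst x), x)"
  "Comp (Mixed G1 th1 G2 th2) (y', u, z) (x, t, y) = (x, u \<cdot> t, z)"
  by (simp_all add: mixed_center_def)

lemma mixed_obj:
  "(A, c) \<in> Obj (Mixed G1 th1 G2 th2) \<longleftrightarrow> A \<in> Obj V \<and> half_braiding M V G1 G2 A c \<and>
    admissible B Psi P F' G1 (comparison th1) G2 (comparison th2) A c"
  by (simp add: mixed_center_def)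

lemma mixed_arr:
  "(x, t, y) \<in> Arr (Mixed G1 th1 G2 th2) \<longleftrightarrow>
    x \<in> Obj (Mixed G1 th1 G2 th2) \<and> y \<in> Obj (Mixed G1 th1 G2 th2) \<and> t \<in> hom V (fst x) (fst y) \<and>
    (\<forall>X\<in>Obj M. (Id V (ob G1 X) \<boxtimes> t) \<cdot> snd x X = snd y X \<cdot> (t \<boxtimes> Id V (ob G2 X)))"
  by (cases x; cases y) (simp add: mixed_center_def)

lemma mixed_objD:
  assumes "over_base_functor G1 th1" "over_base_functor G2 th2" "x \<in> Obj (Mixed G1 th1 G2 th2)"
  shows "fst x \<in> Obj V"
    "X \<in> Obj M \<Longrightarrow> V.crossing (fst x) (ob G1 X) (ob G2 X) (snd x X)"
    "X \<in> Obj M \<Longrightarrow> V.invertible (snd x X)"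
    "snd x \<in> extensional (Obj M)"
    "f \<in> Arr M \<Longrightarrow> (ar G1 f \<boxtimes> Id V (fst x)) \<cdot> snd x (Dom M f) = snd x (Cod M f) \<cdot>
      (Id V (fst x) \<boxtimes> ar G2 f)"
    "X \<in> Obj M \<Longrightarrow> Y \<in> Obj M \<Longrightarrow> (Mu G1 X Y \<boxtimes> Id V (fst x)) \<cdot> snd x (X \<otimes>\<^bsub>M\<^esub> Y) =
       V.cross_past_pair (fst x) (ob G1 X) (ob G1 Y) (ob G2 X) (ob G2 Y) (snd x X) (snd x Y) \<cdot>
         (Id V (fst x) \<boxtimes> Mu G2 X Y)"
    "Y' \<in> Obj B \<Longrightarrow> (comparison th1 Y' \<boxtimes>\<^bsub>B\<^esub> Id B (ob F' (fst x))) \<cdot>\<^bsub>B\<^esub>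
        F'.transport (fst x) (ob G1 (ob P Y')) (ob G2 (ob P Y')) (snd x (ob P Y')) =
       Psi (ob F' (fst x)) Y' \<cdot>\<^bsub>B\<^esub> (Id B (ob F' (fst x)) \<boxtimes>\<^bsub>B\<^esub> comparison th2 Y')"
proof -
  obtain A c where x: "x = (A, c)" by (cases x)
  have A: "A \<in> Obj V" and ad: "admissible B Psi P F' G1 (comparison th1) G2 (comparison th2) A c"
    using assms by (auto simp: mixed_obj x)
  have hb: "c \<in> extensional (Obj M) \<and>
    (\<forall>X\<in>Obj M. V.crossing A (ob G1 X) (ob G2 X) (c X) \<and> V.invertible (c X)) \<and>
    (\<forall>f\<in>Arr M. (ar G1 f \<boxtimes> Id V A) \<cdot> c (Dom M f) = c (Cod M f) \<cdot> (Id V A \<boxtimes> ar G2 f)) \<and>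
    (\<forall>X\<in>Obj M. \<forall>Y\<in>Obj M. (Mu G1 X Y \<boxtimes> Id V A) \<cdot> c (X \<otimes>\<^bsub>M\<^esub> Y) =
       V.cross_past_pair A (ob G1 X) (ob G1 Y) (ob G2 X) (ob G2 Y) (c X) (c Y) \<cdot> (Id V A \<boxtimes> Mu G2 X Y))"
    using half_braiding_iff [OF assms(1,2) [THEN over_base_strong] A, of c] assms(3)
      by (simp add: mixed_obj x)
  show "fst x \<in> Obj V"
    "X \<in> Obj M \<Longrightarrow> V.crossing (fst x) (ob G1 X) (ob G2 X) (snd x X)"
    "X \<in> Obj M \<Longrightarrow> V.invertible (snd x X)"
    "snd x \<in> extensional (Obj M)"
    "f \<in> Arr M \<Longrightarrow> (ar G1 f \<boxtimes> Id V (fst x)) \<cdot> snd x (Dom M f) = snd x (Cod M f) \<cdot>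
      (Id V (fst x) \<boxtimes> ar G2 f)"
    "X \<in> Obj M \<Longrightarrow> Y \<in> Obj M \<Longrightarrow> (Mu G1 X Y \<boxtimes> Id V (fst x)) \<cdot> snd x (X \<otimes>\<^bsub>M\<^esub> Y) =
       V.cross_past_pair (fst x) (ob G1 X) (ob G1 Y) (ob G2 X) (ob G2 Y) (snd x X) (snd x Y) \<cdot>
         (Id V (fst x) \<boxtimes> Mu G2 X Y)"
    using A hb unfolding x fst_conv snd_conv by blast+
  show "Y' \<in> Obj B \<Longrightarrow> (comparison th1 Y' \<boxtimes>\<^bsub>B\<^esub> Id B (ob F' (fst x))) \<cdot>\<^bsub>B\<^esub>
        F'.transport (fst x) (ob G1 (ob P Y')) (ob G2 (ob P Y')) (snd x (ob P Y')) =
       Psi (ob F' (fst x)) Y' \<cdot>\<^bsub>B\<^esub> (Id B (ob F' (fst x)) \<boxtimes>\<^bsub>B\<^esub> comparison th2 Y')"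
    using ad admissible_iff [OF assms(1,2) A, of c] hb unfolding x fst_conv snd_conv by blast
qed

lemma mixed_objI:
  assumes "over_base_functor G1 th1" "over_base_functor G2 th2" "A \<in> Obj V" "c \<in> extensional (Obj M)"
    and c: "\<And>X. X \<in> Obj M \<Longrightarrow> V.crossing A (ob G1 X) (ob G2 X) (c X)"
    "\<And>X. X \<in> Obj M \<Longrightarrow> V.invertible (c X)"
    "\<And>f. f \<in> Arr M \<Longrightarrow> (ar G1 f \<boxtimes> Id V A) \<cdot> c (Dom M f) = c (Cod M f) \<cdot> (Id V A \<boxtimes> ar G2 f)"
    "\<And>X Y. X \<in> Obj M \<Longrightarrow> Y \<in> Obj M \<Longrightarrow> (Mu G1 X Y \<boxtimes> Id V A) \<cdot> c (X \<otimes>\<^bsub>M\<^esub> Y) =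
       V.cross_past_pair A (ob G1 X) (ob G1 Y) (ob G2 X) (ob G2 Y) (c X) (c Y) \<cdot> (Id V A \<boxtimes> Mu G2 X Y)"
    "\<And>X. X \<in> Obj B \<Longrightarrow> (comparison th1 X \<boxtimes>\<^bsub>B\<^esub> Id B (ob F' A)) \<cdot>\<^bsub>B\<^esub>
        F'.transport A (ob G1 (ob P X)) (ob G2 (ob P X)) (c (ob P X)) =
       Psi (ob F' A) X \<cdot>\<^bsub>B\<^esub> (Id B (ob F' A) \<boxtimes>\<^bsub>B\<^esub> comparison th2 X)"
  shows "(A, c) \<in> Obj (Mixed G1 th1 G2 th2)"
proof -
  note a = admissible_iff [where c = c, OF assms(1-3)]
  show ?thesis
    unfolding mixed_obj half_braiding_iff [OF assms(1,2) [THEN over_base_strong] assms(3)]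
    using assms by (subst a) blast+
qed

lemma mixed_arrD:
  assumes "over_base_functor G1 th1" "over_base_functor G2 th2" "(x, t, y) \<in> Arr (Mixed G1 th1 G2 th2)"
  shows "x \<in> Obj (Mixed G1 th1 G2 th2)" "y \<in> Obj (Mixed G1 th1 G2 th2)"
    "t \<in> Arr V" "Dom V t = fst x" "Cod V t = fst y"
    "X \<in> Obj M \<Longrightarrow> (Id V (ob G1 X) \<boxtimes> t) \<cdot> snd x X = snd y X \<cdot> (t \<boxtimes> Id V (ob G2 X))"
  using assms by (auto simp: mixed_arr hom_def)

lemma mixed_hom_cases:
  assumes "f \<in> hom (Mixed G1 th1 G2 th2) x y"
  obtains t where "f = (x, t, y)" "(x, t, y) \<in> Arr (Mixed G1 th1 G2 th2)"
proof -
  obtain x' t y' where "f = (x', t, y')" by (cases f)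
  with assms that show thesis by (auto simp: hom_def)
qed

lemma category_mixed:
  assumes l: "over_base_functor G1 th1" "over_base_functor G2 th2"
  shows "category (Mixed G1 th1 G2 th2)" (is "category ?C")
proof -
  note [simp] = l [THEN over_base_strong] mixed_objD [OF l]
  have c: "(x, u \<cdot> t, z) \<in> Arr ?C" if t: "(x, t, y) \<in> Arr ?C" and u: "(y, u, z) \<in> Arr ?C" for x t y u z
  proof -
    note [simp] = mixed_arrD(1-5) [OF l t] mixed_arrD(1-5) [OF l u]
    have "(Id V (ob G1 X) \<boxtimes> (u \<cdot> t)) \<cdot> snd x X = snd z X \<cdot> ((u \<cdot> t) \<boxtimes> Id V (ob G2 X))"
      if [simp]: "X \<in> Obj M" for X
    proof -
      have "(Id V (ob G1 X) \<boxtimes> (u \<cdot> t)) \<cdot> snd x X = (Id V (ob G1 X) \<boxtimes> u) \<cdot> (Id V (ob G1 X) \<boxtimes> t) \<cdot>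
        snd x X"
        by (simp add: V.tens_comp_rest)
      also have "\<dots> = ((Id V (ob G1 X) \<boxtimes> u) \<cdot> snd y X) \<cdot> (t \<boxtimes> Id V (ob G2 X))"
        by (simp add: mixed_arrD(6) [OF l t])
      also have "\<dots> = snd z X \<cdot> ((u \<cdot> t) \<boxtimes> Id V (ob G2 X))"
        unfolding mixed_arrD(6) [OF l u that] by (simp add: V.tens_comp)
      finally show ?thesis .
    qed
    then show ?thesis by (simp add: mixed_arr V.homI)
  qed
  have i: "(x, Id V (fst x), x) \<in> Arr ?C" if [simp]: "x \<in> Obj ?C" for x
    by (simp add: mixed_arr V.homI)
  note E = mixed_hom_cases
  show ?thesis
  proof (unfold_locales)
    fix f assume f: "f \<in> Arr ?C"
    obtain x t y where "f = (x, t, y)" by (cases f)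
    then show "Dom ?C f \<in> Obj ?C" "Cod ?C f \<in> Obj ?C" using f by (simp_all add: mixed_arr)
  next
    show "Id ?C x \<in> hom ?C x x" if "x \<in> Obj ?C" for x
      using i [OF that] by (simp add: hom_def)
  next
    show "Comp ?C g f \<in> hom ?C x z" if "f \<in> hom ?C x y" "g \<in> hom ?C y z" for f g x y z
      using that by (elim E) (simp add: hom_def c)
  next
    fix f x y assume f: "f \<in> hom ?C x y"
    then obtain t where t: "f = (x, t, y)" "(x, t, y) \<in> Arr ?C" by (rule E)
    note [simp] = mixed_arrD(1-5) [OF l t(2)]
    show "Comp ?C (Id ?C y) f = f" "Comp ?C f (Id ?C x) = f" by (simp_all add: t(1))
  next
    fix f g h w x y z assume f: "f \<in> hom ?C w x" and g: "g \<in> hom ?C x y" and h: "h \<in> hom ?C y z"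
    obtain t where t: "f = (w, t, x)" "(w, t, x) \<in> Arr ?C" using f by (rule E)
    obtain u where u: "g = (x, u, y)" "(x, u, y) \<in> Arr ?C" using g by (rule E)
    obtain v where v: "h = (y, v, z)" "(y, v, z) \<in> Arr ?C" using h by (rule E)
    note [simp] = mixed_arrD(3-5) [OF l t(2)] mixed_arrD(3-5) [OF l u(2)] mixed_arrD(3-5) [OF l v(2)]
    show "Comp ?C (Comp ?C h g) f = Comp ?C h (Comp ?C g f)"
      by (simp add: t(1) u(1) v(1))
  qed
qed

text \<open>In the condition on morphisms \<open>t\<close> occurs as \<open>id \<boxtimes> t\<close> on the left and as \<open>t \<boxtimes> id\<close> on the right,
  so that the condition can be solved for the inverse of \<open>t\<close>.\<close>

lemma mixed_invertible:
  assumes l: "over_base_functor G1 th1" "over_base_functor G2 th2"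
    and t: "(x, t, y) \<in> Arr (Mixed G1 th1 G2 th2)" and "V.invertible t"
  shows "(x, t, y) \<in> iso (Mixed G1 th1 G2 th2) x y"
proof -
  note [simp] = l [THEN over_base_strong] mixed_objD [OF l] mixed_arrD(1-5) [OF l t] \<open>V.invertible t\<close>
  have "(Id V (ob G1 X) \<boxtimes> inv_arr V t) \<cdot> snd y X = snd x X \<cdot> (inv_arr V t \<boxtimes> Id V (ob G2 X))"
    if [simp]: "X \<in> Obj M" for X
  proof (rule V.cancel_left [where f = "Id V (ob G1 X) \<boxtimes> t"])
    have "(Id V (ob G1 X) \<boxtimes> t) \<cdot> snd x X \<cdot> (inv_arr V t \<boxtimes> Id V (ob G2 X)) =
       snd y X \<cdot> (t \<boxtimes> Id V (ob G2 X)) \<cdot> (inv_arr V t \<boxtimes> Id V (ob G2 X))"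
      by (simp add: V.reassoc [OF mixed_arrD(6) [OF l t]])
    then show "(Id V (ob G1 X) \<boxtimes> t) \<cdot> (Id V (ob G1 X) \<boxtimes> inv_arr V t) \<cdot> snd y X =
       (Id V (ob G1 X) \<boxtimes> t) \<cdot> snd x X \<cdot> (inv_arr V t \<boxtimes> Id V (ob G2 X))"
      by (simp add: V.tens_comp)
  qed simp_all
  then have "(y, inv_arr V t, x) \<in> Arr (Mixed G1 th1 G2 th2)"
    by (simp add: mixed_arr V.homI)
  then have "inverse_arrows (Mixed G1 th1 G2 th2) (x, t, y) (y, inv_arr V t, x)"
    using t by (simp add: inverse_arrows_def hom_def)
  then show ?thesis using t unfolding iso_def hom_def by (intro CollectI conjI exI) simp_all
qed

section \<open>Tensor products across mixed centers\<close>

text \<open>Both the tensor product of the relative Drinfeld center and the action are instances; the middle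
  functor \<open>G2\<close> is the target of \<open>y\<close> and the source of \<open>x\<close>.\<close>

definition hb_tensor where
  "hb_tensor G1 G2 G3 x y = (fst x \<otimes> fst y,
     \<lambda>X\<in>Obj M. V.cross_pair (fst x) (fst y) (ob G1 X) (ob G2 X) (ob G3 X) (snd x X) (snd y X))"

lemma fst_hb_tensor [simp]: "fst (hb_tensor G1 G2 G3 x y) = fst x \<otimes> fst y"
  and snd_hb_tensor [simp]: "X \<in> Obj M \<Longrightarrow> snd (hb_tensor G1 G2 G3 x y) X =
     V.cross_pair (fst x) (fst y) (ob G1 X) (ob G2 X) (ob G3 X) (snd x X) (snd y X)"
  by (simp_all add: hb_tensor_def)

text \<open>Naturality is \<open>cross_pair_natural\<close> and tensor-compatibility is \<open>interchange\<close>.  For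
  admissibility, \<open>F'\<close> turns the pasting into the pasting of the transported half-braidings; the
  comparison isomorphisms identify these with the braidings of \<open>F'(A)\<close> and \<open>F'(B)\<close> with \<open>X\<close>, and
  by the second hexagon axiom the latter paste to the braiding of \<open>F'(A) \<otimes> F'(B)\<close> with \<open>X\<close>.\<close>

lemma hb_tensor_obj:
  assumes l: "over_base_functor G1 th1" "over_base_functor G2 th2" "over_base_functor G3 th3"
    and x: "x \<in> Obj (Mixed G1 th1 G2 th2)" and y: "y \<in> Obj (Mixed G2 th2 G3 th3)"
  shows "hb_tensor G1 G2 G3 x y \<in> Obj (Mixed G1 th1 G3 th3)"
  unfolding hb_tensor_def
proof (rule mixed_objI [OF l(1,3)]; (simp only: restrict_extensional)?)
  note D = mixed_objD [OF l(1,2) x] mixed_objD [OF l(2,3) y]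
  note [simp] = l [THEN over_base_strong] mixed_objD(1-4) [OF l(1,2) x] mixed_objD(1-4) [OF l(2,3) y]
  let ?A = "fst x" and ?B = "fst y"
  let ?c = "\<lambda>X. V.cross_pair ?A ?B (ob G1 X) (ob G2 X) (ob G3 X) (snd x X) (snd y X)"
  let ?e = "\<lambda>X\<in>Obj M. ?c X"
  show "?A \<otimes> ?B \<in> Obj V" by simp
  show "V.crossing (?A \<otimes> ?B) (ob G1 X) (ob G3 X) (?e X)" "V.invertible (?e X)" if "X \<in> Obj M" for X
    using that by simp_all
  show "(ar G1 f \<boxtimes> Id V (?A \<otimes> ?B)) \<cdot> ?e (Dom M f) = ?e (Cod M f) \<cdot> (Id V (?A \<otimes> ?B) \<boxtimes> ar G3 f)"
    if f [simp]: "f \<in> Arr M" for f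
  proof -
    have "(ar G1 f \<boxtimes> Id V ?A \<boxtimes> Id V ?B) \<cdot> ?c (Dom M f) = ?c (Cod M f) \<cdot> ((Id V ?A \<boxtimes> Id V ?B) \<boxtimes> ar G3 f)"
      by (rule V.cross_pair_natural [where r = "ar G2 f"])
        (simp_all add: V.homI D(5) [OF f] mixed_objD(5) [OF l(2,3) y f])
    then show ?thesis by simp
  qed
  show "(Mu G1 X Y \<boxtimes> Id V (?A \<otimes> ?B)) \<cdot> ?e (X \<otimes>\<^bsub>M\<^esub> Y) =
     V.cross_past_pair (?A \<otimes> ?B) (ob G1 X) (ob G1 Y) (ob G3 X) (ob G3 Y) (?e X) (?e Y) \<cdot>
       (Id V (?A \<otimes> ?B) \<boxtimes> Mu G3 X Y)"
    if XY [simp]: "X \<in> Obj M" "Y \<in> Obj M" for X Y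
  proof -
    \<comment> \<open>Naturality along \<open>Mu\<close> replaces each factor at \<open>X \<otimes> Y\<close> by a pasting over \<open>X\<close> and \<open>Y\<close>.\<close>
    have "(Mu G1 X Y \<boxtimes> Id V ?A \<boxtimes> Id V ?B) \<cdot> ?c (X \<otimes>\<^bsub>M\<^esub> Y) =
      V.cross_pair ?A ?B (ob G1 X \<otimes> ob G1 Y) (ob G2 X \<otimes> ob G2 Y) (ob G3 X \<otimes> ob G3 Y)
        (V.cross_past_pair ?A (ob G1 X) (ob G1 Y) (ob G2 X) (ob G2 Y) (snd x X) (snd x Y))
        (V.cross_past_pair ?B (ob G2 X) (ob G2 Y) (ob G3 X) (ob G3 Y) (snd y X) (snd y Y)) \<cdot>
      ((Id V ?A \<boxtimes> Id V ?B) \<boxtimes> Mu G3 X Y)"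
      by (rule V.cross_pair_natural [where r = "Mu G2 X Y"])
        (simp_all add: V.homI mixed_objD(6) [OF l(1,2) x XY] mixed_objD(6) [OF l(2,3) y XY])
    then show ?thesis by (simp add: V.interchange)
  qed
  show "(comparison th1 X \<boxtimes>\<^bsub>B\<^esub> Id B (ob F' (?A \<otimes> ?B))) \<cdot>\<^bsub>B\<^esub>
      F'.transport (?A \<otimes> ?B) (ob G1 (ob P X)) (ob G3 (ob P X)) (?e (ob P X)) =
     Psi (ob F' (?A \<otimes> ?B)) X \<cdot>\<^bsub>B\<^esub> (Id B (ob F' (?A \<otimes> ?B)) \<boxtimes>\<^bsub>B\<^esub> comparison th3 X)"
    if X [simp]: "X \<in> Obj B" for X
  proof -
    define s1 s2 s3 where s: "s1 = comparison th1 X" "s2 = comparison th2 X" "s3 = comparison th3 X"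
    have [simp]: "s1 \<in> Arr B" "Dom B s1 = ob F' (ob G1 (ob P X))" "Cod B s1 = X"
        "s2 \<in> Arr B" "Dom B s2 = ob F' (ob G2 (ob P X))" "Cod B s2 = X"
        "s3 \<in> Arr B" "Dom B s3 = ob F' (ob G3 (ob P X))" "Cod B s3 = X"
      unfolding s using over_base_comparison [OF l(1) X] over_base_comparison [OF l(2) X]
        over_base_comparison [OF l(3) X] by blast+
    let ?f = "F'.transport ?A (ob G1 (ob P X)) (ob G2 (ob P X)) (snd x (ob P X))"
    let ?g = "F'.transport ?B (ob G2 (ob P X)) (ob G3 (ob P X)) (snd y (ob P X))"
    let ?t = "F'.transport (?A \<otimes> ?B) (ob G1 (ob P X)) (ob G3 (ob P X)) (?c (ob P X))"
    let ?k = "B.cross_pair (ob F' ?A) (ob F' ?B) (ob F' (ob G1 (ob P X))) (ob F' (ob G2 (ob P X)))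
        (ob F' (ob G3 (ob P X))) ?f ?g"
    have t: "(Id B (ob F' (ob G1 (ob P X))) \<boxtimes>\<^bsub>B\<^esub> Mu F' ?A ?B) \<cdot>\<^bsub>B\<^esub> ?t =
      ?k \<cdot>\<^bsub>B\<^esub> (Mu F' ?A ?B \<boxtimes>\<^bsub>B\<^esub> Id B (ob F' (ob G3 (ob P X))))"
      by (rule F'.transport_cross_pair) simp_all
    have n: "(s1 \<boxtimes>\<^bsub>B\<^esub> Id B (ob F' ?A) \<boxtimes>\<^bsub>B\<^esub> Id B (ob F' ?B)) \<cdot>\<^bsub>B\<^esub> ?k =
      B.cross_pair (ob F' ?A) (ob F' ?B) X X X (Psi (ob F' ?A) X) (Psi (ob F' ?B) X) \<cdot>\<^bsub>B\<^esub>
      ((Id B (ob F' ?A) \<boxtimes>\<^bsub>B\<^esub> Id B (ob F' ?B)) \<boxtimes>\<^bsub>B\<^esub> s3)"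
      by (rule B.cross_pair_natural [where r = s2])
        (simp_all add: B.homI mixed_objD(7) [OF l(1,2) x X, folded s] mixed_objD(7) [OF l(2,3) y X,
          folded s])
    have "(s1 \<boxtimes>\<^bsub>B\<^esub> Id B (ob F' (?A \<otimes> ?B))) \<cdot>\<^bsub>B\<^esub> ?t =
      Psi (ob F' (?A \<otimes> ?B)) X \<cdot>\<^bsub>B\<^esub> (Id B (ob F' (?A \<otimes> ?B)) \<boxtimes>\<^bsub>B\<^esub> s3)" (is "?l = ?r")
    \<comment> \<open>Composing with \<open>Mu\<close> replaces \<open>F'(A \<otimes> B)\<close> by \<open>F'(A) \<otimes> F'(B)\<close>, where the hexagon applies.\<close>
    proof (rule B.cancel_left [where f = "Id B X \<boxtimes>\<^bsub>B\<^esub> Mu F' ?A ?B"])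
      have p: "(Id B X \<boxtimes>\<^bsub>B\<^esub> Mu F' ?A ?B) \<cdot>\<^bsub>B\<^esub> Psi (ob F' (?A \<otimes> ?B)) X =
          Psi (ob F' ?A \<otimes>\<^bsub>B\<^esub> ob F' ?B) X \<cdot>\<^bsub>B\<^esub> (Mu F' ?A ?B \<boxtimes>\<^bsub>B\<^esub> Id B X)"
        using B.psi_natural [of "Mu F' ?A ?B" "Id B X"] by simp
      have "(Id B X \<boxtimes>\<^bsub>B\<^esub> Mu F' ?A ?B) \<cdot>\<^bsub>B\<^esub> ?l =
          (s1 \<boxtimes>\<^bsub>B\<^esub> Id B (ob F' ?A \<otimes>\<^bsub>B\<^esub> ob F' ?B)) \<cdot>\<^bsub>B\<^esub> (Id B (ob F' (ob G1 (ob P X))) \<boxtimes>\<^bsub>B\<^esub> Mu F' ?A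
            ?B) \<cdot>\<^bsub>B\<^esub> ?t"
        by (simp add: B.tens_comp_rest)
      also have "\<dots> = ((s1 \<boxtimes>\<^bsub>B\<^esub> Id B (ob F' ?A) \<boxtimes>\<^bsub>B\<^esub> Id B (ob F' ?B)) \<cdot>\<^bsub>B\<^esub> ?k) \<cdot>\<^bsub>B\<^esub>
        (Mu F' ?A ?B \<boxtimes>\<^bsub>B\<^esub> Id B (ob F' (ob G3 (ob P X))))"
        by (simp add: t)
      also have "\<dots> = Psi (ob F' ?A \<otimes>\<^bsub>B\<^esub> ob F' ?B) X \<cdot>\<^bsub>B\<^esub> (Mu F' ?A ?B \<boxtimes>\<^bsub>B\<^esub> s3)"
        unfolding n by (simp add: B.psi_cross_pair B.tens_comp)
      also have "\<dots> = (Id B X \<boxtimes>\<^bsub>B\<^esub> Mu F' ?A ?B) \<cdot>\<^bsub>B\<^esub> ?r"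
        by (simp add: B.reassoc [OF p] B.tens_comp)
      finally show "(Id B X \<boxtimes>\<^bsub>B\<^esub> Mu F' ?A ?B) \<cdot>\<^bsub>B\<^esub> ?l = (Id B X \<boxtimes>\<^bsub>B\<^esub> Mu F' ?A ?B) \<cdot>\<^bsub>B\<^esub> ?r" .
    qed simp_all
    then show ?thesis by (simp add: s)
  qed
qed

text \<open>This is admissibility of the identity half-braiding of the unit.  Both sides become \<open>Eps \<boxtimes> s\<close>
  after composition with \<open>id \<boxtimes> Eps\<close>: on the left by the unit axioms of \<open>F'\<close>, on the right by
  naturality of the braiding and \<open>psi_unit_left\<close>.\<close>

lemma transport_unit:
  assumes [simp]: "y \<in> Obj V" "X \<in> Obj B" "s \<in> Arr B" "Dom B s = ob F' y" "Cod B s = X"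
  shows "(s \<boxtimes>\<^bsub>B\<^esub> Id B (ob F' (Unit V))) \<cdot>\<^bsub>B\<^esub> F'.transport (Unit V) y y (Id V y) =
     Psi (ob F' (Unit V)) X \<cdot>\<^bsub>B\<^esub> (Id B (ob F' (Unit V)) \<boxtimes>\<^bsub>B\<^esub> s)" (is "?l = ?r")
proof (rule B.cancel_left [where f = "Id B X \<boxtimes>\<^bsub>B\<^esub> Eps F'"])
  note [simp] = V.unit_obj B.unit_obj V.unit_left_ob V.unit_right_ob B.unit_left_ob B.unit_right_ob
  have e [simp]: "B.invertible (Eps F')" "Eps F' \<in> Arr B" "Dom B (Eps F') = ob F' (Unit V)"
    "Cod B (Eps F') = Unit B"
    using B.isoD [OF F'.eps_iso] by auto
  show "B.invertible (Id B X \<boxtimes>\<^bsub>B\<^esub> Eps F')" by simp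
  have p: "(Id B X \<boxtimes>\<^bsub>B\<^esub> Eps F') \<cdot>\<^bsub>B\<^esub> Psi (ob F' (Unit V)) X = Eps F' \<boxtimes>\<^bsub>B\<^esub> Id B X"
    using B.psi_natural [of "Eps F'" "Id B X"] by (simp add: B.psi_unit_left)
  have m: "(Id B (ob F' y) \<boxtimes>\<^bsub>B\<^esub> Eps F') \<cdot>\<^bsub>B\<^esub> Mu F' y (Unit V) = Id B (ob F' y)"
    by (rule F'.mu_unit_right) simp
  have "(Id B X \<boxtimes>\<^bsub>B\<^esub> Eps F') \<cdot>\<^bsub>B\<^esub> ?l =
      (s \<boxtimes>\<^bsub>B\<^esub> Id B (Unit B)) \<cdot>\<^bsub>B\<^esub> (Id B (ob F' y) \<boxtimes>\<^bsub>B\<^esub> Eps F') \<cdot>\<^bsub>B\<^esub> Mu F' y (Unit V) \<cdot>\<^bsub>B\<^esub> inv_arr B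
        (Mu F' (Unit V) y)"
    by (simp add: F'.transport_def B.tens_comp_rest)
  also have "\<dots> = s \<cdot>\<^bsub>B\<^esub> (Eps F' \<boxtimes>\<^bsub>B\<^esub> Id B (ob F' y))"
    by (simp add: B.reassoc [OF m] F'.inv_mu_unit B.unit_right_ar)
  also have "\<dots> = (Id B (Unit B) \<boxtimes>\<^bsub>B\<^esub> s) \<cdot>\<^bsub>B\<^esub> (Eps F' \<boxtimes>\<^bsub>B\<^esub> Id B (ob F' y))"
    by (simp add: B.unit_left_ar)
  also have "\<dots> = (Id B X \<boxtimes>\<^bsub>B\<^esub> Eps F') \<cdot>\<^bsub>B\<^esub> ?r"
    by (simp add: B.reassoc [OF p] B.tens_comp)
  finally show "(Id B X \<boxtimes>\<^bsub>B\<^esub> Eps F') \<cdot>\<^bsub>B\<^esub> ?l = (Id B X \<boxtimes>\<^bsub>B\<^esub> Eps F') \<cdot>\<^bsub>B\<^esub> ?r" .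
qed (simp_all add: V.unit_obj V.unit_left_ob V.unit_right_ob B.isoD [OF F'.eps_iso])

definition hb_unit where
  "hb_unit K = (Unit V, \<lambda>X\<in>Obj M. Id V (ob K X))"

lemma fst_hb_unit [simp]: "fst (hb_unit K) = Unit V"
  by (simp add: hb_unit_def)

lemma hb_unit_obj:
  assumes l: "over_base_functor K th"
  shows "hb_unit K \<in> Obj (Mixed K th K th)"
  unfolding hb_unit_def
proof (rule mixed_objI [OF l l]; (simp only: restrict_extensional V.unit_obj)?)
  note [simp] = l [THEN over_base_strong] V.unit_obj V.unit_left_ob V.unit_right_ob V.unit_left_ar
    V.unit_right_ar
  show "V.crossing (Unit V) (ob K X) (ob K X) ((\<lambda>X\<in>Obj M. Id V (ob K X)) X)"
    "V.invertible ((\<lambda>X\<in>Obj M. Id V (ob K X)) X)" if "X \<in> Obj M" for X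
    using that by simp_all
  show "(ar K f \<boxtimes> Id V (Unit V)) \<cdot> (\<lambda>X\<in>Obj M. Id V (ob K X)) (Dom M f) =
      (\<lambda>X\<in>Obj M. Id V (ob K X)) (Cod M f) \<cdot> (Id V (Unit V) \<boxtimes> ar K f)" if "f \<in> Arr M" for f
    using that by simp
  show "(Mu K X Y \<boxtimes> Id V (Unit V)) \<cdot> (\<lambda>X\<in>Obj M. Id V (ob K X)) (X \<otimes>\<^bsub>M\<^esub> Y) =
     V.cross_past_pair (Unit V) (ob K X) (ob K Y) (ob K X) (ob K Y) ((\<lambda>X\<in>Obj M. Id V (ob K X)) X)
       ((\<lambda>X\<in>Obj M. Id V (ob K X)) Y) \<cdot> (Id V (Unit V) \<boxtimes> Mu K X Y)"
    if "X \<in> Obj M" "Y \<in> Obj M" for X Y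
    using that by (simp add: V.cross_past_pair_unit)
  show "(comparison th X \<boxtimes>\<^bsub>B\<^esub> Id B (ob F' (Unit V))) \<cdot>\<^bsub>B\<^esub>
      F'.transport (Unit V) (ob K (ob P X)) (ob K (ob P X)) ((\<lambda>X\<in>Obj M. Id V (ob K X)) (ob P X)) =
     Psi (ob F' (Unit V)) X \<cdot>\<^bsub>B\<^esub> (Id B (ob F' (Unit V)) \<boxtimes>\<^bsub>B\<^esub> comparison th X)"
    if X [simp]: "X \<in> Obj B" for X
    using transport_unit [of "ob K (ob P X)" X "comparison th X"] over_base_comparison [OF l X] by simp
qed

lemma hb_tensor_unit:
  assumes l: "over_base_functor G1 th1" "over_base_functor G2 th2"
    and x: "x \<in> Obj (Mixed G1 th1 G2 th2)"
  shows "hb_tensor G1 G1 G2 (hb_unit G1) x = x" "hb_tensor G1 G2 G2 x (hb_unit G2) = x"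
proof -
  note [simp] = l [THEN over_base_strong] mixed_objD(1-3) [OF l x] V.unit_left_ob V.unit_right_ob
    V.cross_pair_unit_left V.cross_pair_unit_right
  have f: "fst (hb_tensor G1 G1 G2 (hb_unit G1) x) = fst x"
    "fst (hb_tensor G1 G2 G2 x (hb_unit G2)) = fst x"
    by (simp_all add: hb_unit_def)
  have "snd (hb_tensor G1 G1 G2 (hb_unit G1) x) = snd x"
    by (rule extensionalityI [where A = "Obj M"])
      (simp_all add: mixed_objD(4) [OF l x], simp_all add: hb_tensor_def hb_unit_def)
  moreover have "snd (hb_tensor G1 G2 G2 x (hb_unit G2)) = snd x"
    by (rule extensionalityI [where A = "Obj M"])
      (simp_all add: mixed_objD(4) [OF l x], simp_all add: hb_tensor_def hb_unit_def)
  ultimately show "hb_tensor G1 G1 G2 (hb_unit G1) x = x" "hb_tensor G1 G2 G2 x (hb_unit G2) = x"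
    using f by (simp_all add: prod_eq_iff)
qed

definition hb_tensor_arr where
  "hb_tensor_arr G1 G2 G3 f g =
    (hb_tensor G1 G2 G3 (fst f) (fst g), fst (snd f) \<boxtimes> fst (snd g), hb_tensor G1 G2 G3 (snd (snd f))
      (snd (snd g)))"

lemma hb_tensor_arr:
  assumes l: "over_base_functor G1 th1" "over_base_functor G2 th2" "over_base_functor G3 th3"
    and t: "(x, t, x') \<in> Arr (Mixed G1 th1 G2 th2)" and u: "(y, u, y') \<in> Arr (Mixed G2 th2 G3 th3)"
  shows "(hb_tensor G1 G2 G3 x y, t \<boxtimes> u, hb_tensor G1 G2 G3 x' y') \<in> Arr (Mixed G1 th1 G3 th3)"
proof -
  note T = mixed_arrD [OF l(1,2) t] and U = mixed_arrD [OF l(2,3) u]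
  note [simp] = l [THEN over_base_strong] T(1-5) U(1-5) mixed_objD(1-4) [OF l(1,2) T(1)]
    mixed_objD(1-4) [OF l(1,2) T(2)]
    mixed_objD(1-4) [OF l(2,3) U(1)] mixed_objD(1-4) [OF l(2,3) U(2)] hb_tensor_obj [OF l]
  have "(Id V (ob G1 X) \<boxtimes> t \<boxtimes> u) \<cdot> snd (hb_tensor G1 G2 G3 x y) X =
      snd (hb_tensor G1 G2 G3 x' y') X \<cdot> ((t \<boxtimes> u) \<boxtimes> Id V (ob G3 X))" if X [simp]: "X \<in> Obj M" for X
    unfolding snd_hb_tensor [OF X]
    by (rule V.cross_pair_natural [where r = "Id V (ob G2 X)"])
      (simp_all add: V.homI T(6) [OF X] U(6) [OF X])
  then show ?thesis by (simp add: mixed_arr V.homI)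
qed

text \<open>Compatibility with composition and identities is inherited from the tensor product of \<open>V\<close>,
  because an arrow of a mixed center is determined by its ends and its underlying arrow.\<close>

lemma hb_tensor_functor:
  assumes l: "over_base_functor G1 th1" "over_base_functor G2 th2" "over_base_functor G3 th3"
  shows "cat_functor (prod_cat (Mixed G1 th1 G2 th2) (Mixed G2 th2 G3 th3)) (Mixed G1 th1 G3 th3)
    \<lparr>ob = (\<lambda>(x, y). hb_tensor G1 G2 G3 x y), ar = (\<lambda>(f, g). hb_tensor_arr G1 G2 G3 f g)\<rparr>"
    (is "cat_functor (prod_cat ?C ?D) ?E ?F")
proof -
  interpret C: category ?C by (rule category_mixed [OF l(1,2)])
  interpret D: category ?D by (rule category_mixed [OF l(2,3)])
  interpret E: category ?E by (rule category_mixed [OF l(1,3)])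
  interpret CD: category "prod_cat ?C ?D" by (rule category_prod_cat) unfold_locales
  show ?thesis
  proof
    fix z assume "z \<in> Obj (prod_cat ?C ?D)"
    then obtain x y where z: "z = (x, y)" and xy: "x \<in> Obj ?C" "y \<in> Obj ?D" by auto
    then show "ob ?F z \<in> Obj ?E" by (simp add: hb_tensor_obj [OF l])
    show "ar ?F (Id (prod_cat ?C ?D) z) = Id ?E (ob ?F z)"
      using mixed_objD(1) [OF l(1,2) xy(1)] mixed_objD(1) [OF l(2,3) xy(2)]
        by (simp add: z hb_tensor_arr_def)
  next
    fix f z z' assume f: "f \<in> hom (prod_cat ?C ?D) z z'"
    obtain x y x' y' h k where [simp]: "z = (x, y)" "z' = (x', y')" "f = (h, k)"
      by (cases z; cases z'; cases f)
    obtain t where "h = (x, t, x')" "(x, t, x') \<in> Arr ?C"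
      using f by (auto simp: hom_prod_cat elim: mixed_hom_cases)
    moreover obtain u where "k = (y, u, y')" "(y, u, y') \<in> Arr ?D"
      using f by (auto simp: hom_prod_cat elim: mixed_hom_cases)
    ultimately show "ar ?F f \<in> hom ?E (ob ?F z) (ob ?F z')"
      using hb_tensor_arr [OF l] by (simp add: hb_tensor_arr_def hom_def)
  next
    fix f g z z' z'' assume f: "f \<in> hom (prod_cat ?C ?D) z z'" and g: "g \<in> hom (prod_cat ?C ?D) z' z''"
    obtain x y x' y' x'' y'' h k h' k' where [simp]: "z = (x, y)" "z' = (x', y')" "z'' = (x'', y'')"
      "f = (h, k)" "g = (h', k')" by (cases z; cases z'; cases z''; cases f; cases g)
    obtain t where t: "h = (x, t, x')" "(x, t, x') \<in> Arr ?C"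
      using f by (auto simp: hom_prod_cat elim: mixed_hom_cases)
    obtain u where u: "k = (y, u, y')" "(y, u, y') \<in> Arr ?D"
      using f by (auto simp: hom_prod_cat elim: mixed_hom_cases)
    obtain t' where t': "h' = (x', t', x'')" "(x', t', x'') \<in> Arr ?C"
      using g by (auto simp: hom_prod_cat elim: mixed_hom_cases)
    obtain u' where u': "k' = (y', u', y'')" "(y', u', y'') \<in> Arr ?D"
      using g by (auto simp: hom_prod_cat elim: mixed_hom_cases)
    note [simp] = mixed_arrD(3-5) [OF l(1,2) t(2)] mixed_arrD(3-5) [OF l(1,2) t'(2)]
      mixed_arrD(3-5) [OF l(2,3) u(2)] mixed_arrD(3-5) [OF l(2,3) u'(2)]
    show "ar ?F (Comp (prod_cat ?C ?D) g f) = Comp ?E (ar ?F g) (ar ?F f)"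
      by (simp add: t(1) u(1) t'(1) u'(1) hb_tensor_arr_def V.tens_comp)
  qed
qed

definition hb_assoc where
  "hb_assoc G1 G2 G3 G4 x y z =
    (hb_tensor G1 G3 G4 (hb_tensor G1 G2 G3 x y) z, Assoc V (fst x) (fst y) (fst z),
     hb_tensor G1 G2 G4 x (hb_tensor G2 G3 G4 y z))"

text \<open>The underlying arrow is invertible in \<open>V\<close>, so only the condition on morphisms is at stake; at
  each object of \<open>M\<close> it is \<open>cross_pair_assoc\<close>.\<close>

lemma hb_assoc_iso:
  assumes l: "over_base_functor G1 th1" "over_base_functor G2 th2" "over_base_functor G3 th3"
    "over_base_functor G4 th4"
    and x: "x \<in> Obj (Mixed G1 th1 G2 th2)" and y: "y \<in> Obj (Mixed G2 th2 G3 th3)"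
        and z: "z \<in> Obj (Mixed G3 th3 G4 th4)"
  shows "hb_assoc G1 G2 G3 G4 x y z \<in> iso (Mixed G1 th1 G4 th4)
    (hb_tensor G1 G3 G4 (hb_tensor G1 G2 G3 x y) z) (hb_tensor G1 G2 G4 x (hb_tensor G2 G3 G4 y z))"
  unfolding hb_assoc_def
proof (rule mixed_invertible [OF l(1,4)])
  note [simp] = l [THEN over_base_strong] mixed_objD(1-4) [OF l(1,2) x] mixed_objD(1-4) [OF l(2,3)
    y] mixed_objD(1-4) [OF l(3,4) z]
  show "V.invertible (Assoc V (fst x) (fst y) (fst z))" by simp
  have "hb_tensor G1 G3 G4 (hb_tensor G1 G2 G3 x y) z \<in> Obj (Mixed G1 th1 G4 th4)"
    "hb_tensor G1 G2 G4 x (hb_tensor G2 G3 G4 y z) \<in> Obj (Mixed G1 th1 G4 th4)"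
    using x y z by (blast intro: hb_tensor_obj l)+
  then show "(hb_tensor G1 G3 G4 (hb_tensor G1 G2 G3 x y) z, Assoc V (fst x) (fst y) (fst z),
     hb_tensor G1 G2 G4 x (hb_tensor G2 G3 G4 y z)) \<in> Arr (Mixed G1 th1 G4 th4)"
    by (simp add: mixed_arr V.homI V.cross_pair_assoc)
qed

lemma hb_assoc_natural:
  assumes l: "over_base_functor G1 th1" "over_base_functor G2 th2" "over_base_functor G3 th3"
    "over_base_functor G4 th4"
    and f: "f \<in> hom (Mixed G1 th1 G2 th2) x x'" and g: "g \<in> hom (Mixed G2 th2 G3 th3) y y'"
    and h: "h \<in> hom (Mixed G3 th3 G4 th4) z z'"
  shows "Comp (Mixed G1 th1 G4 th4) (hb_tensor_arr G1 G2 G4 f (hb_tensor_arr G2 G3 G4 g h))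
    (hb_assoc G1 G2 G3 G4 x y z) =
    Comp (Mixed G1 th1 G4 th4) (hb_assoc G1 G2 G3 G4 x' y' z') (hb_tensor_arr G1 G3 G4
        (hb_tensor_arr G1 G2 G3 f g) h)"
proof -
  obtain t where t: "f = (x, t, x')" "(x, t, x') \<in> Arr (Mixed G1 th1 G2 th2)" using f
    by (rule mixed_hom_cases)
  obtain u where u: "g = (y, u, y')" "(y, u, y') \<in> Arr (Mixed G2 th2 G3 th3)" using g
    by (rule mixed_hom_cases)
  obtain v where v: "h = (z, v, z')" "(z, v, z') \<in> Arr (Mixed G3 th3 G4 th4)" using h
    by (rule mixed_hom_cases)
  note [simp] = mixed_arrD(3-5) [OF l(1,2) t(2)] mixed_arrD(3-5) [OF l(2,3) u(2)]
    mixed_arrD(3-5) [OF l(3,4) v(2)]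
  show ?thesis
    using V.al_nat [of t u v] by (simp add: t(1) u(1) v(1) hb_tensor_arr_def hb_assoc_def)
qed

lemma hb_assoc_pentagon:
  assumes l: "over_base_functor G1 th1" "over_base_functor G2 th2" "over_base_functor G3 th3"
    "over_base_functor G4 th4" "over_base_functor G5 th5"
    and w: "w \<in> Obj (Mixed G1 th1 G2 th2)" and x: "x \<in> Obj (Mixed G2 th2 G3 th3)"
    and y: "y \<in> Obj (Mixed G3 th3 G4 th4)" and z: "z \<in> Obj (Mixed G4 th4 G5 th5)"
  defines "E \<equiv> Mixed G1 th1 G5 th5"
  shows "Comp E (hb_tensor_arr G1 G2 G5 (w, Id V (fst w), w) (hb_assoc G2 G3 G4 G5 x y z))
      (Comp E (hb_assoc G1 G2 G4 G5 w (hb_tensor G2 G3 G4 x y) z)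
        (hb_tensor_arr G1 G4 G5 (hb_assoc G1 G2 G3 G4 w x y) (z, Id V (fst z), z))) =
     Comp E (hb_assoc G1 G2 G3 G5 w x (hb_tensor G3 G4 G5 y z)) (hb_assoc G1 G3 G4 G5 (hb_tensor G1
         G2 G3 w x) y z)"
  unfolding E_def
  by (simp add: hb_tensor_arr_def hb_assoc_def V.pentagon
      mixed_objD(1) [OF l(1,2) w] mixed_objD(1) [OF l(2,3) x] mixed_objD(1) [OF l(3,4) y]
          mixed_objD(1) [OF l(4,5) z])

section \<open>The monoidal center and its actions\<close>

text \<open>The relative Drinfeld center with an arbitrary functor and comparison in place of \<open>G\<close> and the
  identities, expressed by the operations on mixed centers.\<close>

definition center where
  "center K th =
    \<lparr>Obj = Obj (Mixed K th K th), Arr = Arr (Mixed K th K th), Dom = Dom (Mixed K th K th),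
      Cod = Cod (Mixed K th K th),
     Id = Id (Mixed K th K th), Comp = Comp (Mixed K th K th),
     Tens_ob = hb_tensor K K K, Tens_ar = hb_tensor_arr K K K, Unit = hb_unit K, Assoc = hb_assoc K
         K K K\<rparr>"

lemma center_simps [simp]:
  "Obj (center K th) = Obj (Mixed K th K th)" "Arr (center K th) = Arr (Mixed K th K th)"
  "Dom (center K th) = Dom (Mixed K th K th)" "Cod (center K th) = Cod (Mixed K th K th)"
  "Id (center K th) = Id (Mixed K th K th)" "Comp (center K th) = Comp (Mixed K th K th)"
  "Tens_ob (center K th) = hb_tensor K K K" "Tens_ar (center K th) = hb_tensor_arr K K K"
  "Unit (center K th) = hb_unit K" "Assoc (center K th) = hb_assoc K K K K"
  by (simp_all add: center_def)

lemma center_hom: "hom (center K th) = hom (Mixed K th K th)"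
  by (simp add: hom_def fun_eq_iff)

lemma center_iso: "iso (center K th) = iso (Mixed K th K th)"
  by (simp add: iso_def inverse_arrows_def center_hom fun_eq_iff)

lemma center_prod_cat:
  "prod_cat (center K th) D = prod_cat (Mixed K th K th) D" "prod_cat D (center K th) =
    prod_cat D (Mixed K th K th)"
  by (simp_all add: prod_cat_def)

lemma category_center:
  assumes "over_base_functor K th"
  shows "category (center K th)"
  using category_mixed [OF assms assms] by (simp add: category_def center_hom)

lemma cat_functor_center:
  assumes "over_base_functor K th" "cat_functor C (Mixed K th K th) Fu"
  shows "cat_functor C (center K th) Fu"
  using assms by (simp add: cat_functor_def cat_functor_axioms_def center_hom category_center)

lemma hb_tensor_arr_unit:
  assumes l: "over_base_functor G1 th1" "over_base_functor G2 th2"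
    and f: "f \<in> Arr (Mixed G1 th1 G2 th2)"
  shows "hb_tensor_arr G1 G1 G2 (hb_unit G1, Id V (Unit V), hb_unit G1) f = f"
    "hb_tensor_arr G1 G2 G2 f (hb_unit G2, Id V (Unit V), hb_unit G2) = f"
proof -
  obtain x t y where t: "f = (x, t, y)" by (cases f)
  note D = mixed_arrD [OF l f [unfolded t]]
  show "hb_tensor_arr G1 G1 G2 (hb_unit G1, Id V (Unit V), hb_unit G1) f = f"
    "hb_tensor_arr G1 G2 G2 f (hb_unit G2, Id V (Unit V), hb_unit G2) = f"
    using D by (simp_all add: t hb_tensor_arr_def hb_tensor_unit [OF l] V.unit_left_ar V.unit_right_ar)
qed

lemma hb_assoc_triangle:
  assumes l: "over_base_functor G1 th1" "over_base_functor G2 th2" "over_base_functor G3 th3"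
    and x: "x \<in> Obj (Mixed G1 th1 G2 th2)" and y: "y \<in> Obj (Mixed G2 th2 G3 th3)"
  shows "hb_assoc G1 G2 G2 G3 x (hb_unit G2) y = Id (Mixed G1 th1 G3 th3) (hb_tensor G1 G2 G3 x y)"
  using mixed_objD(1) [OF l(1,2) x] mixed_objD(1) [OF l(2,3) y] hb_tensor_unit [OF l(1,2) x]
    hb_tensor_unit [OF l(2,3) y]
  by (simp add: hb_assoc_def V.triangle hb_unit_def)

lemma monoidal_category_center:
  assumes l: "over_base_functor K th"
  shows "monoidal_category (center K th)"
proof -
  interpret Z: category "center K th" by (rule category_center [OF l])
  show ?thesis
  proof (intro monoidal_category.intro monoidal_category_axioms.intro)
    show "cat_functor (prod_cat (center K th) (center K th)) (center K th)
      \<lparr>ob = \<lambda>(x, y). Tens_ob (center K th) x y, ar = \<lambda>(f, g). Tens_ar (center K th) f g\<rparr>"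
      using cat_functor_center [OF l hb_tensor_functor [OF l l l]] by (simp add: center_prod_cat)
  next
    show "Unit (center K th) \<in> Obj (center K th)" by (simp add: hb_unit_obj [OF l])
  next
    fix f g h x x' y y' z z'
    assume "f \<in> hom (center K th) x x'" "g \<in> hom (center K th) y y'" "h \<in> hom (center K th) z z'"
    then show "Comp (center K th) (Tens_ar (center K th) f (Tens_ar (center K th) g h))
        (Assoc (center K th) x y z) =
      Comp (center K th) (Assoc (center K th) x' y' z') (Tens_ar (center K th)
          (Tens_ar (center K th) f g) h)"
      using hb_assoc_natural [OF l l l l] by (simp add: center_hom)
  next
    fix w x y z
    assume "w \<in> Obj (center K th)" "x \<in> Obj (center K th)" "y \<in> Obj (center K th)"
        "z \<in> Obj (center K th)"
    then show "Comp (center K th) (Tens_ar (center K th) (Id (center K th) w) (Assoc (center K th) x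
        y z))
       (Comp (center K th) (Assoc (center K th) w (Tens_ob (center K th) x y) z)
         (Tens_ar (center K th) (Assoc (center K th) w x y) (Id (center K th) z))) =
      Comp (center K th) (Assoc (center K th) w x (Tens_ob (center K th) y z))
        (Assoc (center K th) (Tens_ob (center K th) w x) y z)"
      using hb_assoc_pentagon [OF l l l l l] by simp
  qed (simp_all add: Z.category_axioms hb_tensor_unit [OF l l] hb_tensor_arr_unit [OF l l]
      center_iso hb_assoc_iso [OF l l l l]
      hb_assoc_triangle [OF l l l])
qed

text \<open>The axioms of a module category are the monoidal category axioms for products of mixed centers
  with the last factor taken from \<open>H\<close>; since the unit of \<open>V\<close> is strict, so is the unit of the
  action.\<close>

lemma center_acts:
  assumes l: "over_base_functor G1 th1" "over_base_functor G2 th2"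
  defines "H \<equiv> Mixed G1 th1 G2 th2"
  shows "left_module_category (center G1 th1) H
    \<lparr>ob = (\<lambda>(x, y). hb_tensor G1 G1 G2 x y), ar = (\<lambda>(f, g). hb_tensor_arr G1 G1 G2 f g)\<rparr>
    (hb_assoc G1 G1 G1 G2) (Id H)"
    (is "left_module_category ?Z H ?act ?as ?un")
proof -
  interpret Z: monoidal_category ?Z by (rule monoidal_category_center [OF l(1)])
  interpret H: category H unfolding H_def by (rule category_mixed [OF l])
  show ?thesis
  proof (intro left_module_category.intro left_module_category_axioms.intro)
    show "cat_functor (prod_cat ?Z H) H ?act"
      using hb_tensor_functor [OF l(1) l(1) l(2)] by (simp add: center_prod_cat H_def)
  next
    fix x y n assume "x \<in> Obj ?Z" "y \<in> Obj ?Z" "n \<in> Obj H"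
    then show "?as x y n \<in> iso H (ob ?act (Tens_ob ?Z x y, n)) (ob ?act (x, ob ?act (y, n)))"
      using hb_assoc_iso [OF l(1) l(1) l(1) l(2)] by (simp add: H_def)
  next
    fix f g h x x' y y' n n' assume "f \<in> hom ?Z x x'" "g \<in> hom ?Z y y'" "h \<in> hom H n n'"
    then show "Comp H (ar ?act (f, ar ?act (g, h))) (?as x y n) =
       Comp H (?as x' y' n') (ar ?act (Tens_ar ?Z f g, h))"
      using hb_assoc_natural [OF l(1) l(1) l(1) l(2)] by (simp add: H_def center_hom)
  next
    fix w x y n assume "w \<in> Obj ?Z" "x \<in> Obj ?Z" "y \<in> Obj ?Z" "n \<in> Obj H"
    then show "Comp H (ar ?act (Id ?Z w, ?as x y n)) (Comp H (?as w (Tens_ob ?Z x y) n)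
        (ar ?act (Assoc ?Z w x y, Id H n))) =
       Comp H (?as w x (ob ?act (y, n))) (?as (Tens_ob ?Z w x) y n)"
      using hb_assoc_pentagon [OF l(1) l(1) l(1) l(1) l(2)] by (simp add: H_def)
  next
    fix n assume n: "n \<in> Obj H"
    then show "?un n \<in> iso H (ob ?act (Unit ?Z, n)) n"
      using H.isoI [of "Id H n" n n] by (simp add: hb_tensor_unit [OF l, folded H_def])
  next
    fix h n n' assume h: "h \<in> hom H n n'"
    then show "Comp H h (?un n) = Comp H (?un n') (ar ?act (Id ?Z (Unit ?Z), h))"
      using H.homD [OF h] by (simp add: hb_tensor_arr_unit [OF l, folded H_def])
  next
    fix x n assume x: "x \<in> Obj ?Z" and n: "n \<in> Obj H"
    have t: "hb_tensor G1 G1 G2 x n \<in> Obj H" using hb_tensor_obj [OF l(1) l(1) l(2)] x n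
      by (simp add: H_def)
    have [simp]: "fst x \<in> Obj V" "fst n \<in> Obj V"
      using x n mixed_objD(1) [OF l(1) l(1), of x] mixed_objD(1) [OF l, of n] by (simp_all add: H_def)
    have i: "hb_tensor_arr G1 G1 G2 (x, Id V (fst x), x) (n, Id V (fst n), n) =
      Id H (hb_tensor G1 G1 G2 x n)"
      by (simp add: hb_tensor_arr_def H_def)
    show "Comp H (ar ?act (Id ?Z x, ?un n)) (?as x (Unit ?Z) n) = Id H (ob ?act (x, n))"
      using x n t i hb_assoc_triangle [OF l(1) l(1) l(2), of x n] by (simp add: H_def)
  qed (unfold_locales)
qed

end

section \<open>The relative Hopf center\<close>

context relative_setting
begin

sublocale center_setting V M B Psi F' P tau
  by unfold_locales (rule P.ob_obj)

lemma ob_F'_G [simp]: "X \<in> Obj M \<Longrightarrow> ob F' (ob G X) = ob F X"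
  using over_base by (simp add: monfunc_eq_def comp_monfunc_def)

lemma tau_simps [simp]:
  assumes "X \<in> Obj B"
  shows "B.invertible (tau X)" "tau X \<in> Arr B" "Dom B (tau X) = ob F (ob P X)" "Cod B (tau X) = X"
  using B.isoD [OF tau.component_iso [OF assms]] by (simp_all add: comp_monfunc_def id_monfunc_def)

lemma over_base_G: "over_base_functor G (\<lambda>X. Id B (ob F X))"
  unfolding over_base_functor_def strong_functor_def
  by (auto intro!: F'.source.homI F'.source.isoI B.isoI)

text \<open>The comparison \<open>F'GPFP(X) = FPFP(X) \<rightarrow> FP(X) \<rightarrow> X\<close> applies \<open>\<tau>\<close> twice.\<close>

lemma over_base_GPF: "over_base_functor (comp_monfunc V G (comp_monfunc M P F)) (\<lambda>X. tau (ob F X))"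
  unfolding over_base_functor_def strong_functor_def
  by (auto intro!: F'.source.homI F'.source.isoI B.isoI simp: comp_monfunc_def)

lemma hopf_center: "relative_hopf_center B Psi M F P tau V F' G =
    Mixed G (\<lambda>X. Id B (ob F X)) (comp_monfunc V G (comp_monfunc M P F)) (\<lambda>X. tau (ob F X))"
  by (simp add: relative_hopf_center_def)

lemma tensor_half_braiding: "tensor_half_braiding M V G = hb_tensor G G G"
  by (simp add: fun_eq_iff tensor_half_braiding_def hb_tensor_def F'.source.cross_pair_def
    cong: restrict_cong)

lemma drinfeld_center: "relative_drinfeld_center B Psi M F P tau V F' G = center G (\<lambda>X. Id B (ob F X))"
  by (simp add: relative_drinfeld_center_def center_def tensor_half_braiding hb_unit_def Let_def
      hb_assoc_def hb_tensor_arr_def fun_eq_iff)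

end

theorem theorem2p2p14:
  fixes B :: "('bo, 'ba) moncat" and Psi :: "'bo \<Rightarrow> 'bo \<Rightarrow> 'ba"
    and M :: "('mo, 'ma) moncat"
    and F :: "('mo, 'ma, 'bo, 'ba) monfunc" and P :: "('bo, 'ba, 'mo, 'ma) monfunc"
    and tau :: "'bo \<Rightarrow> 'ba"
    and V :: "('vo, 'va) moncat" and F' :: "('vo, 'va, 'bo, 'ba) monfunc"
    and G :: "('mo, 'ma, 'vo, 'va) monfunc"
  assumes "relative_setting B Psi M F P tau V F' G"
  defines "Z \<equiv> relative_drinfeld_center B Psi M F P tau V F' G"
    and "H \<equiv> relative_hopf_center B Psi M F P tau V F' G"
  shows "\<exists>act massoc munit.
    left_module_category Z H act massoc munit \<and>
    (\<forall>A c W d. (A, c) \<in> Obj Z \<longrightarrow> (W, d) \<in> Obj H \<longrightarrow>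
      ob act ((A, c), (W, d)) =
        (A \<otimes>\<^bsub>V\<^esub> W,
         \<lambda>X\<in>Obj M.
           Assoc V (ob G X) A W \<cdot>\<^bsub>V\<^esub>
           (c X \<boxtimes>\<^bsub>V\<^esub> Id V W) \<cdot>\<^bsub>V\<^esub>
           inv_arr V (Assoc V A (ob G X) W) \<cdot>\<^bsub>V\<^esub>
           (Id V A \<boxtimes>\<^bsub>V\<^esub> d X) \<cdot>\<^bsub>V\<^esub>
           Assoc V A W (ob G (ob P (ob F X)))))"
proof -
  interpret relative_setting B Psi M F P tau V F' G by fact
  show ?thesis
    unfolding Z_def H_def drinfeld_center hopf_center
    by (intro exI conjI, rule center_acts [OF over_base_G over_base_GPF])
      (simp add: hb_tensor_def F'.source.cross_pair_def comp_monfunc_def)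
qed

end
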